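(* Let $G$ be a unicyclic graph of order at least three. Let $H_1$ be the graph obtained from the disjoint union $K_1\cup C_3$ by joining an edge between the vertex of $K_1$ and a vertex of $C_3$, let $H_2$ be the graph obtained from the disjoint union $K_1\cup C_4$ by joining an edge between the vertex of $K_1$ and a vertex of $C_4$, and let $H_3$ be the graph obtained from $P_6$ by joining an edge between the two support vertices of $P_6$. Then (with equality of graphs understood up to isomorphism) $$\mathrm{Sd}_f(G,\overline{G})=\begin{cases}\dim_f(G)=\dim_f(\overline{G})+\frac12 & \text{if } G\in\{H_1,H_2\},\\ \dim_f(G)=\dim_f(\overline{G})+\frac13 & \text{if } G=H_3,\\ \dim_f(\overline{G}) & \text{otherwise.}\end{cases}$$
   Context: Graphs are finite, simple and undirected, and need not be connected. A unicyclic graph is a connected graph containing exactly one cycle. $\overline{G}$ is the complement of $G$ (on the same vertex set); $P_n$, $C_n$, $K_n$ are the path, cycle and complete graph on $n$ vertices. A support vertex is a vertex adjacent to a vertex of degree one. $d_G(x,y)$ is the least number of edges on a path joining $x$ and $y$ in $G$ ($\infty$ if there is none). For distinct $x,y\in V(G)$, $R_G\{x,y\}=\{z\in V(G): d_G(x,z)\ne d_G(y,z)\}$. For a function $g$ on $V$ and $U\subseteq V$, $g(U)=\sum_{s\in U}g(s)$. A resolving function of $G$ is a function $g:V(G)\to[0,1]$ with $g(R_G\{x,y\})\ge 1$ for all distinct $x,y\in V(G)$; the fractional dimension $\dim_f(G)$ is the minimum of $g(V(G))$ over all resolving functions $g$ of $G$. $\mathrm{Sd}_f(G,\overline{G})$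 is the minimum of $g(V(G))$ over all functions $g:V(G)\to[0,1]$ that are resolving functions of both $G$ and $\overline{G}$. *)

theory Defs
  imports "HOL-Analysis.Analysis" "HOL-Library.Extended_Nat"
begin

(* A graph is a pair of a vertex set and a set of edges, the edges being two-element vertex sets. *)
type_synonym 'a graph = "'a set \<times> 'a set set"

abbreviation verts :: "'a graph \<Rightarrow> 'a set" where
  "verts G \<equiv> fst G"

abbreviation edges :: "'a graph \<Rightarrow> 'a set set" where
  "edges G \<equiv> snd G"

definition simple_graph :: "'a graph \<Rightarrow> bool" where
  "simple_graph G \<longleftrightarrow> finite (verts G) \<and> (\<forall>e\<in>edges G. e \<subseteq> verts G \<and> card e = 2)"

definition complement :: "'a graph \<Rightarrow> 'a graph" where
  "complement G = (verts G, {e. e \<subseteq> verts G \<and> card e = 2} - edges G)"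

definition subgraph :: "'a graph \<Rightarrow> 'a graph \<Rightarrow> bool" where
  "subgraph H G \<longleftrightarrow> simple_graph H \<and> verts H \<subseteq> verts G \<and> edges H \<subseteq> edges G"

definition isomorphic :: "'a graph \<Rightarrow> 'b graph \<Rightarrow> bool" where
  "isomorphic G H \<longleftrightarrow> (\<exists>f. bij_betw f (verts G) (verts H) \<and>
     (\<forall>x\<in>verts G. \<forall>y\<in>verts G. {x, y} \<in> edges G \<longleftrightarrow> {f x, f y} \<in> edges H))"

definition complete_graph :: "nat \<Rightarrow> nat graph" where
  "complete_graph n = ({..<n}, {e. e \<subseteq> {..<n} \<and> card e = 2})"

definition path_graph :: "nat \<Rightarrow> nat graph" where
  "path_graph n = ({..<n}, {{i, Suc i} | i. Suc i < n})"

(* This is a simple graph, namely C_n, only for n at least 3. *)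
definition cycle_graph :: "nat \<Rightarrow> nat graph" where
  "cycle_graph n = ({..<n}, {{i, Suc i mod n} | i. i < n})"

definition disjoint_union :: "'a graph \<Rightarrow> 'b graph \<Rightarrow> ('a + 'b) graph" where
  "disjoint_union G H =
     (Inl ` verts G \<union> Inr ` verts H, (image Inl) ` edges G \<union> (image Inr) ` edges H)"

definition add_edge :: "'a \<Rightarrow> 'a \<Rightarrow> 'a graph \<Rightarrow> 'a graph" where
  "add_edge x y G = (verts G, insert {x, y} (edges G))"

definition vertex_degree :: "'a graph \<Rightarrow> 'a \<Rightarrow> nat" where
  "vertex_degree G x = card {y \<in> verts G. {x, y} \<in> edges G}"

definition support_vertex :: "'a graph \<Rightarrow> 'a \<Rightarrow> bool" where
  "support_vertex G x \<longleftrightarrow>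
     x \<in> verts G \<and> (\<exists>y\<in>verts G. {x, y} \<in> edges G \<and> vertex_degree G y = 1)"

definition path_between :: "'a graph \<Rightarrow> 'a \<Rightarrow> 'a \<Rightarrow> 'a list \<Rightarrow> bool" where
  "path_between G x y p \<longleftrightarrow> p \<noteq> [] \<and> hd p = x \<and> last p = y \<and> set p \<subseteq> verts G \<and> distinct p \<and>
     successively (\<lambda>u v. {u, v} \<in> edges G) p"

definition connected_graph :: "'a graph \<Rightarrow> bool" where
  "connected_graph G \<longleftrightarrow> verts G \<noteq> {} \<and> (\<forall>x\<in>verts G. \<forall>y\<in>verts G. \<exists>p. path_between G x y p)"

(* The infimum of the empty set in enat is \<infinity>, which covers vertices not joined by a path. *)
definition graph_dist :: "'a graph \<Rightarrow> 'a \<Rightarrow> 'a \<Rightarrow> enat" where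
  "graph_dist G x y = (INF p\<in>{p. path_between G x y p}. enat (length p - 1))"

(* Cycles are subgraphs, so they carry neither a base point nor an orientation. *)
definition cycle_of :: "'a graph \<Rightarrow> 'a graph \<Rightarrow> bool" where
  "cycle_of G C \<longleftrightarrow> subgraph C G \<and> (\<exists>n\<ge>3. isomorphic C (cycle_graph n))"

definition unicyclic :: "'a graph \<Rightarrow> bool" where
  "unicyclic G \<longleftrightarrow> simple_graph G \<and> connected_graph G \<and> (\<exists>!C. cycle_of G C)"

definition resolving_set :: "'a graph \<Rightarrow> 'a \<Rightarrow> 'a \<Rightarrow> 'a set" where
  "resolving_set G x y = {z \<in> verts G. graph_dist G x z \<noteq> graph_dist G y z}"

definition resolving_function :: "'a graph \<Rightarrow> ('a \<Rightarrow> real) \<Rightarrow> bool" where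
  "resolving_function G g \<longleftrightarrow> (\<forall>v\<in>verts G. 0 \<le> g v \<and> g v \<le> 1) \<and>
     (\<forall>x\<in>verts G. \<forall>y\<in>verts G. x \<noteq> y \<longrightarrow> 1 \<le> sum g (resolving_set G x y))"

(* The minima in the next two definitions exist for simple graphs; see below. *)
definition dim_f :: "'a graph \<Rightarrow> real" where
  "dim_f G = (LEAST r. \<exists>g. resolving_function G g \<and> r = sum g (verts G))"

(* G and H are meant to have the same vertex set. *)
definition Sd_f :: "'a graph \<Rightarrow> 'a graph \<Rightarrow> real" where
  "Sd_f G H = (LEAST r. \<exists>g. resolving_function G g \<and> resolving_function H g \<and> r = sum g (verts G))"

definition H1 :: "(nat + nat) graph" where
  "H1 = add_edge (Inl 0) (Inr 0) (disjoint_union (complete_graph 1) (cycle_graph 3))"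

definition H2 :: "(nat + nat) graph" where
  "H2 = add_edge (Inl 0) (Inr 0) (disjoint_union (complete_graph 1) (cycle_graph 4))"

(* 1 and 4 are the support vertices of path_graph 6; see below. *)
definition H3 :: "nat graph" where
  "H3 = add_edge 1 4 (path_graph 6)"

lemma support_vertices_path_graph_6: "{x. support_vertex (path_graph 6) x} = {1, 4}"
proof -
  have v: "verts (path_graph 6) = {..<6}" by (simp add: path_graph_def)
  have e: "{x, y} \<in> edges (path_graph 6) \<longleftrightarrow> y < 6 \<and> y = Suc x \<or> x < 6 \<and> x = Suc y" for x y
    by (auto simp: path_graph_def doubleton_eq_iff)
  have deg: "vertex_degree (path_graph 6) y = 1 \<longleftrightarrow> y = 0 \<or> y = 5" if "y < 6" for y
  proof -
    have "{z \<in> {..<6}. z < 6 \<and> z = Suc y \<or> y < 6 \<and> y = Suc z} =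
        (if y = 0 then {1} else if y = 5 then {4} else {y - 1, y + 1})"
      using that by auto
    then show ?thesis unfolding vertex_degree_def v e by simp
  qed
  show ?thesis unfolding support_vertex_def v e using deg by force
qed

lemma graph_dist_refl: "x \<in> verts G \<Longrightarrow> graph_dist G x x = 0"
proof -
  assume "x \<in> verts G"
  then have "path_between G x x [x]" by (simp add: path_between_def)
  then have "graph_dist G x x \<le> enat (length [x] - 1)"
    unfolding graph_dist_def by (intro INF_lower) simp
  then show ?thesis by (simp add: zero_enat_def[symmetric])
qed

lemma graph_dist_pos: "x \<noteq> y \<Longrightarrow> graph_dist G x y \<noteq> 0"
proof -
  assume "x \<noteq> y"
  then have "1 \<le> enat (length p - 1)" if "path_between G x y p" for p
    using that by (cases p; cases "tl p") (auto simp: path_between_def one_enat_def)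
  then have "1 \<le> graph_dist G x y"
    unfolding graph_dist_def by (intro INF_greatest) simp
  then show ?thesis by auto
qed

lemma resolving_function_one:
  assumes "simple_graph G"
  shows "resolving_function G (\<lambda>_. 1)"
  unfolding resolving_function_def
proof (intro conjI ballI impI)
  fix x y assume xy: "x \<in> verts G" "y \<in> verts G" "x \<noteq> y"
  then have "x \<in> resolving_set G x y"
    using graph_dist_refl[of x G] graph_dist_pos[of y x G] by (simp add: resolving_set_def)
  moreover have "finite (resolving_set G x y)"
    using assms by (simp add: simple_graph_def resolving_set_def)
  ultimately have "card (resolving_set G x y) > 0" by (auto simp: card_gt_0_iff)
  then show "(1::real) \<le> sum (\<lambda>_. 1) (resolving_set G x y)" by simp
qed auto

lemma Sd_f_attained:
  fixes G H :: "'a graph"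
  assumes G: "simple_graph G" and H: "simple_graph H" and V: "verts H = verts G"
  shows "\<exists>g. resolving_function G g \<and> resolving_function H g \<and> Sd_f G H = sum g (verts G) \<and>
    (\<forall>h. resolving_function G h \<and> resolving_function H h \<longrightarrow> sum g (verts G) \<le> sum h (verts G))"
proof -
  define C where "C = {g. resolving_function G g \<and> resolving_function H g}"
  define B :: "('a \<Rightarrow> real) set" where "B = PiE UNIV (\<lambda>_. {0..1})"
  have cont: "continuous_on UNIV (\<lambda>g::'a \<Rightarrow> real. sum g A)" for A
    by (intro continuous_intros continuous_on_product_coordinates)
  have "closed {g. resolving_function K g}" for K :: "'a graph"
    unfolding resolving_function_def Ball_def imp_conv_disj
    by (intro closed_Collect_conj closed_Collect_all closed_Collect_disj closed_Collect_le
      closed_Collect_const continuous_on_const continuous_on_product_coordinates cont)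
  then have "closed C" unfolding C_def Collect_conj_eq by (intro closed_Int)
  moreover have "compactin (product_topology (\<lambda>_. euclidean) UNIV) B"
    unfolding B_def compactin_PiE by (simp add: compactin_euclidean_iff)
  then have "compact B"
    by (simp add: euclidean_product_topology)
  ultimately have "compact (B \<inter> C)" by (simp add: compact_Int_closed)
  moreover have "(\<lambda>_. 1) \<in> B \<inter> C"
    using resolving_function_one[OF G] resolving_function_one[OF H] by (auto simp: B_def C_def)
  ultimately obtain g where g: "g \<in> B \<inter> C"
    and min: "\<And>h. h \<in> B \<inter> C \<Longrightarrow> sum g (verts G) \<le> sum h (verts G)"
    using continuous_attains_inf[of "B \<inter> C" "\<lambda>g. sum g (verts G)"]
      continuous_on_subset[OF cont] by blast
  have le: "sum g (verts G) \<le> sum h (verts G)"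
    if h: "resolving_function G h" "resolving_function H h" for h
  proof -
    define h' where "h' = (\<lambda>v. if v \<in> verts G then h v else 0)"
    have *: "sum h' A = sum h A" if "A \<subseteq> verts G" for A
      using that by (intro sum.cong) (auto simp: h'_def)
    have "resolving_set G x y \<subseteq> verts G" "resolving_set H x y \<subseteq> verts G" for x y
      using V by (auto simp: resolving_set_def)
    then have "h' \<in> B \<inter> C"
      using h V unfolding B_def C_def resolving_function_def
      by (auto simp: *) (auto simp: h'_def)
    then show ?thesis using min[of h'] *[of "verts G"] by simp
  qed
  have "Sd_f G H = sum g (verts G)"
    unfolding Sd_f_def using g le by (intro Least_equality) (auto simp: C_def)
  then show ?thesis using g le by (auto simp: C_def)
qed

lemma dim_f_attained:
  assumes "simple_graph G"
  shows "\<exists>g. resolving_function G g \<and> dim_f G = sum g (verts G) \<and>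
    (\<forall>h. resolving_function G h \<longrightarrow> sum g (verts G) \<le> sum h (verts G))"
proof -
  have "dim_f G = Sd_f G G" by (simp add: dim_f_def Sd_f_def)
  then show ?thesis using Sd_f_attained[OF assms assms refl] by simp
qed

end

theory Submission
  imports Defs "HOL-Combinatorics.Transposition"
begin

text \<open>
  Say that \<open>z\<close> resolves a pair \<open>u\<close>, \<open>v\<close> by adjacency if \<open>z\<close> is one of the two or is adjacent to exactly
  one of them. This notion is the same for a graph \<open>G\<close> and its complement, and it implies resolution by
  distance in both. So a function that resolves all pairs by adjacency is feasible for the simultaneous
  problem, and if it is as light as the complement alone permits, then
  \<open>Sd_f G (complement G) = dim_f (complement G)\<close> (\<open>Sd_f_eq_dim_f_complement\<close>).

  Two adjacent vertices are at distance two in the complement unless every vertex is adjacent to one of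
  them, that is, unless they span a dominating edge. If there is no dominating edge, the complement
  resolves by adjacency only, and the equation is immediate (\<open>Sd_f_eq_if_no_dominating_edge\<close>).

  If a unicyclic graph has a dominating edge \<open>xy\<close>, it is a double star with centres \<open>x\<close> and \<open>y\<close> plus
  one edge (\<open>unicyclic_dominating_edge_cases\<close>). The cycle is then a triangle on the edge \<open>xy\<close>, a triangle
  at one of the centres, or a square on \<open>xy\<close>, and the only parameters are the two sets of leaves. In each
  of these families an explicit function, mostly one with values \<open>0\<close> and \<open>1/2\<close>, resolves by adjacency.
  Its optimality for the complement comes from a few pairs with small resolving sets: two twins, such as
  two leaves with the same neighbour, are resolved by themselves only (\<open>complement_twin_pair\<close>), and
  other pairs by adjacency and possibly one centre (\<open>complement_pair\<close>).

  Three members of the families remain, the graphs \<open>H1\<close>, \<open>H2\<close> and \<open>H3\<close>. There the complement has a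
  lighter function that uses distances of three or more, whereas in \<open>G\<close> itself the corresponding pairs
  are resolved by few vertices; a lightest function for \<open>G\<close> resolves by adjacency, which gives
  \<open>Sd_f G (complement G) = dim_f G\<close>, and both values are computed.
\<close>

section \<open>Neighbourhoods and small distances\<close>

definition nbhd :: "'a graph \<Rightarrow> 'a \<Rightarrow> 'a set" where
  "nbhd G v = {z. {v, z} \<in> edges G}"

lemma nbhd_sym: "u \<in> nbhd G v \<longleftrightarrow> v \<in> nbhd G u"
  by (simp add: nbhd_def insert_commute)

lemma nbhd_subset_verts: "simple_graph G \<Longrightarrow> nbhd G v \<subseteq> verts G"
  by (auto simp: nbhd_def simple_graph_def)

lemma not_in_own_nbhd: "simple_graph G \<Longrightarrow> v \<notin> nbhd G v"
  by (force simp: nbhd_def simple_graph_def)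

lemma finite_verts: "simple_graph G \<Longrightarrow> finite (verts G)"
  by (simp add: simple_graph_def)

lemma verts_complement [simp]: "verts (complement G) = verts G"
  by (simp add: complement_def)

lemma simple_graph_complement: "simple_graph G \<Longrightarrow> simple_graph (complement G)"
  by (auto simp: simple_graph_def complement_def)

lemma nbhd_complement:
  "v \<in> verts G \<Longrightarrow> nbhd (complement G) v = verts G - insert v (nbhd G v)"
  by (auto simp: nbhd_def complement_def card_2_iff doubleton_eq_iff)

lemma graph_dist_le: "path_between G u v p \<Longrightarrow> graph_dist G u v \<le> enat (length p - 1)"
  unfolding graph_dist_def by (intro INF_lower) simp

lemma graph_dist_geI:
  "(\<And>p. path_between G u v p \<Longrightarrow> k \<le> length p - 1) \<Longrightarrow> enat k \<le> graph_dist G u v"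
  unfolding graph_dist_def by (intro INF_greatest) simp

lemma graph_dist_adjacent:
  assumes "simple_graph G" "v \<in> nbhd G u"
  shows "graph_dist G u v = enat 1"
proof (rule antisym)
  have "u \<in> verts G" "v \<in> verts G" "u \<noteq> v"
    using assms nbhd_subset_verts nbhd_sym not_in_own_nbhd by fast+
  then have "path_between G u v [u, v]"
    using assms(2) by (simp add: path_between_def nbhd_def)
  then show "graph_dist G u v \<le> enat 1" using graph_dist_le by fastforce
  show "enat 1 \<le> graph_dist G u v"
  proof (rule graph_dist_geI)
    fix p assume "path_between G u v p"
    then show "1 \<le> length p - 1" using \<open>u \<noteq> v\<close>
      by (cases p; cases "tl p") (auto simp: path_between_def)
  qed
qed

lemma graph_dist_nonadjacent:
  assumes "u \<noteq> v" "v \<notin> nbhd G u"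
  shows "enat 2 \<le> graph_dist G u v"
proof (rule graph_dist_geI)
  fix p assume p: "path_between G u v p"
  then obtain q where q: "p = u # q" by (cases p) (auto simp: path_between_def)
  with p assms obtain a r where "q = a # r" by (cases q) (auto simp: path_between_def)
  with p q assms show "2 \<le> length p - 1"
    by (cases r) (auto simp: path_between_def nbhd_def)
qed

lemma graph_dist_no_common_neighbour:
  assumes "u \<noteq> v" "v \<notin> nbhd G u" "nbhd G u \<inter> nbhd G v = {}"
  shows "enat 3 \<le> graph_dist G u v"
proof (rule graph_dist_geI)
  fix p assume p: "path_between G u v p"
  then obtain q where q: "p = u # q" by (cases p) (auto simp: path_between_def)
  with p assms obtain a r where r: "q = a # r" by (cases q) (auto simp: path_between_def)
  with p q assms obtain b s where s: "r = b # s"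
    by (cases r) (auto simp: path_between_def nbhd_def)
  have "s \<noteq> []"
  proof
    assume "s = []"
    with p q r s have "a \<in> nbhd G u" "v \<in> nbhd G a" by (auto simp: path_between_def nbhd_def)
    then show False using assms(3) nbhd_sym by fast
  qed
  then show "3 \<le> length p - 1" using q r s by (cases s) auto
qed

lemma graph_dist_two:
  assumes "simple_graph G" "u \<noteq> v" "v \<notin> nbhd G u" "c \<in> nbhd G u" "c \<in> nbhd G v"
  shows "graph_dist G u v = enat 2"
proof (rule antisym)
  have "u \<in> verts G" "v \<in> verts G" "c \<in> verts G" "u \<noteq> c" "c \<noteq> v" "{c, v} \<in> edges G"
    using assms nbhd_subset_verts nbhd_sym not_in_own_nbhd by (fast | simp add: nbhd_def insert_commute)+
  then have "path_between G u v [u, c, v]"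
    using assms by (simp add: path_between_def nbhd_def)
  then show "graph_dist G u v \<le> enat 2" using graph_dist_le[of G u v "[u, c, v]"] by (simp add: numeral_2_eq_2)
qed (rule graph_dist_nonadjacent[OF assms(2,3)])

section \<open>Distances in the complement\<close>

text \<open>
  Resolution by adjacency alone, that is, by distances truncated at two. A graph and its
  complement agree on it, so it mediates between their resolving sets.
\<close>

definition adj_res_set :: "'a graph \<Rightarrow> 'a \<Rightarrow> 'a \<Rightarrow> 'a set" where
  "adj_res_set G u v = {u, v} \<union> (nbhd G u - nbhd G v) \<union> (nbhd G v - nbhd G u)"

lemma adj_res_set_commute: "adj_res_set G u v = adj_res_set G v u"
  by (auto simp: adj_res_set_def)

lemma adj_res_set_complement:
  assumes "simple_graph G" "u \<in> verts G" "v \<in> verts G"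
  shows "adj_res_set (complement G) u v = adj_res_set G u v"
  using assms nbhd_subset_verts[OF assms(1)] by (auto simp: adj_res_set_def nbhd_complement)

lemma adj_res_set_subset:
  assumes "simple_graph G" "u \<in> verts G" "v \<in> verts G" "u \<noteq> v"
  shows "adj_res_set G u v \<subseteq> resolving_set G u v"
proof -
  have *: "z \<in> resolving_set G u v \<and> z \<in> resolving_set G v u"
    if "u \<in> verts G" "v \<in> verts G" "z = u \<or> z \<in> nbhd G u - nbhd G v" "u \<noteq> v" for z u v
  proof (cases "z = u")
    case True
    then show ?thesis using that graph_dist_refl[of u G] graph_dist_pos[of v u G]
      by (auto simp: resolving_set_def)
  next
    case False
    with that have z: "z \<in> nbhd G u" "z \<notin> nbhd G v" by auto
    have "z \<in> verts G" using z nbhd_subset_verts[OF assms(1)] by auto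
    moreover have "graph_dist G v z \<noteq> enat 1"
      using z graph_dist_nonadjacent[of v z G] graph_dist_refl[of z G] \<open>z \<in> verts G\<close>
      by (cases "v = z") (auto simp: zero_enat_def)
    ultimately show ?thesis using graph_dist_adjacent[OF assms(1) z(1)]
      by (auto simp: resolving_set_def)
  qed
  show ?thesis using *[of u v] *[of v u] assms by (auto simp: adj_res_set_def)
qed

text \<open>
  The dominating edges of a graph are the pairs of its adjacent vertices that are at distance
  three or more (possibly infinite) in the complement; the other adjacent pairs are at distance two
  there.
\<close>

definition dominating_edge :: "'a graph \<Rightarrow> 'a \<Rightarrow> 'a \<Rightarrow> bool" where
  "dominating_edge G u v \<longleftrightarrow> v \<in> nbhd G u \<and> verts G \<subseteq> nbhd G u \<union> nbhd G v"

lemma complement_dist_nonadjacent: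
  assumes "simple_graph G" "u \<in> verts G" "z \<in> verts G" "u \<noteq> z" "z \<notin> nbhd G u"
  shows "graph_dist (complement G) u z = enat 1"
  using assms by (intro graph_dist_adjacent simple_graph_complement) (auto simp: nbhd_complement)

lemma complement_dist_two:
  assumes "simple_graph G" "z \<in> nbhd G u" "\<not> dominating_edge G u z"
  shows "graph_dist (complement G) u z = enat 2"
proof -
  have "u \<in> verts G" "z \<in> verts G" "u \<noteq> z" "u \<in> nbhd G z"
    using assms nbhd_subset_verts nbhd_sym not_in_own_nbhd by fast+
  moreover obtain c where "c \<in> verts G" "c \<notin> nbhd G u" "c \<notin> nbhd G z"
    using assms by (auto simp: dominating_edge_def)
  ultimately show ?thesis
    using assms by (intro graph_dist_two[where c = c] simple_graph_complement) (auto simp: nbhd_complement)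
qed

lemma complement_dist_dominating_edge:
  assumes "simple_graph G" "dominating_edge G u z"
  shows "graph_dist (complement G) u z \<noteq> enat 2"
proof -
  have "z \<in> nbhd G u" using assms by (simp add: dominating_edge_def)
  then have "u \<in> verts G" "z \<in> verts G" "u \<noteq> z"
    using assms nbhd_subset_verts nbhd_sym not_in_own_nbhd by fast+
  then have "enat 3 \<le> graph_dist (complement G) u z"
    using assms by (intro graph_dist_no_common_neighbour) (auto simp: nbhd_complement dominating_edge_def)
  then show ?thesis by auto
qed

text \<open>
  Only dominating edges make complement distances exceed two, so only they can let the complement
  resolve a pair that adjacency does not: the resolving vertex is then a common neighbour of the
  pair, joined to at least one of the two by a dominating edge.
\<close>

lemma resolving_set_complement_subset:
  assumes "simple_graph G" "u \<in> verts G" "v \<in> verts G"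
  shows "resolving_set (complement G) u v \<subseteq> adj_res_set G u v \<union>
    {z \<in> nbhd G u \<inter> nbhd G v. dominating_edge G u z \<or> dominating_edge G v z}"
proof
  fix z assume z: "z \<in> resolving_set (complement G) u v"
  then have "z \<in> verts G" and ne: "graph_dist (complement G) u z \<noteq> graph_dist (complement G) v z"
    by (simp_all add: resolving_set_def)
  then show "z \<in> adj_res_set G u v \<union>
    {z \<in> nbhd G u \<inter> nbhd G v. dominating_edge G u z \<or> dominating_edge G v z}"
    using ne assms complement_dist_nonadjacent[OF assms(1), of u z]
      complement_dist_nonadjacent[OF assms(1), of v z]
      complement_dist_two[OF assms(1), of z u] complement_dist_two[OF assms(1), of z v]
    unfolding adj_res_set_def by (smt (verit) Diff_iff IntI UnCI insertCI mem_Collect_eq)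
qed

lemma resolving_set_complement_dominating:
  assumes "simple_graph G" "z \<in> nbhd G u \<inter> nbhd G v"
    and "dominating_edge G u z \<longleftrightarrow> \<not> dominating_edge G v z"
  shows "z \<in> resolving_set (complement G) u v"
proof -
  have "z \<in> verts G" using assms nbhd_subset_verts by fast
  then show ?thesis
    using assms complement_dist_dominating_edge[OF assms(1), of u z]
      complement_dist_dominating_edge[OF assms(1), of v z]
      complement_dist_two[OF assms(1), of z u] complement_dist_two[OF assms(1), of z v]
    unfolding resolving_set_def by fastforce
qed

text \<open>
  Exchanging two twins is an automorphism, so every other vertex is equally far from both.
\<close>

lemma twins_resolving_set:
  assumes G: "simple_graph G" and V: "u \<in> verts G" "v \<in> verts G"
    and twins: "nbhd G u - {v} = nbhd G v - {u}"
  shows "resolving_set G u v \<subseteq> {u, v}"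
proof -
  let ?t = "Transposition.transpose u v"
  have same: "c \<in> nbhd G u \<longleftrightarrow> c \<in> nbhd G v" if "c \<noteq> u" "c \<noteq> v" for c
    using twins that by blast
  have adj: "?t b \<in> nbhd G (?t a)" if ab: "b \<in> nbhd G a" for a b
  proof -
    have ne: "a \<noteq> b" using ab not_in_own_nbhd[OF G] by blast
    have ba: "a \<in> nbhd G b" using ab nbhd_sym by fast
    consider "a \<in> {u, v}" "b \<in> {u, v}" | "a \<notin> {u, v}" "b \<in> {u, v}"
      | "a \<in> {u, v}" "b \<notin> {u, v}" | "a \<notin> {u, v}" "b \<notin> {u, v}"
      by blast
    then show ?thesis
    proof cases
      case 1
      then have "?t a = b" "?t b = a" using ne by auto
      then show ?thesis using ba by simp
    next
      case 2
      then have "a \<in> nbhd G (?t b)" using ba same[of a] by auto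
      then show ?thesis using 2 nbhd_sym[of a G "?t b"] by simp
    next
      case 3
      then have "b \<in> nbhd G (?t a)" using ab same[of b] by auto
      then show ?thesis using 3 by simp
    next
      case 4
      then show ?thesis using ab by simp
    qed
  qed
  have path: "path_between G (?t a) (?t b) (map ?t p)" if "path_between G a b p" for a b p
  proof -
    have "?t ` verts G \<subseteq> verts G" using V by (auto simp: Transposition.transpose_def)
    moreover have "successively (\<lambda>a b. {?t a, ?t b} \<in> edges G) p"
      using that adj by (auto simp: path_between_def nbhd_def intro: successively_mono)
    moreover have "inj_on ?t (set p)" by (meson inj_on_subset inj_transpose subset_UNIV)
    ultimately show ?thesis using that
      by (auto simp: path_between_def hd_map last_map distinct_map successively_map)
  qed
  have le: "graph_dist G (?t a) (?t b) \<le> graph_dist G a b" for a b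
    unfolding graph_dist_def[of G a b]
    using graph_dist_le[OF path] by (intro INF_greatest) fastforce
  have "graph_dist G u z = graph_dist G v z" if "z \<noteq> u" "z \<noteq> v" for z
    using le[of u z] le[of v z] that by simp
  then show ?thesis by (auto simp: resolving_set_def)
qed

lemma adj_res_set_subset_complement:
  assumes "simple_graph G" "u \<in> verts G" "v \<in> verts G" "u \<noteq> v"
  shows "adj_res_set G u v \<subseteq> resolving_set (complement G) u v"
  using adj_res_set_subset[OF simple_graph_complement[OF assms(1)], of u v]
    adj_res_set_complement[OF assms(1-3)] assms by simp

section \<open>Upper bounds from functions that resolve by adjacency\<close>

lemma sum_mono_superset:
  fixes h :: "'a \<Rightarrow> real"
  assumes "finite T" "S \<subseteq> T" "\<And>v. v \<in> T \<Longrightarrow> 0 \<le> h v" "1 \<le> sum h S"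
  shows "1 \<le> sum h T"
  using assms(4) sum_mono2[OF assms(1,2), of h] assms(3) by force

lemma sum_list_le_sum:
  fixes g :: "'a \<Rightarrow> real"
  assumes "finite S" "set ds \<subseteq> S" "distinct ds" "\<And>v. v \<in> S \<Longrightarrow> 0 \<le> g v"
  shows "sum_list (map g ds) \<le> sum g S"
  using sum_mono2[OF assms(1,2), of g] assms(4) sum_list_distinct_conv_sum_set[OF assms(3), of g] by simp

definition adj_resolving_function :: "'a graph \<Rightarrow> ('a \<Rightarrow> real) \<Rightarrow> bool" where
  "adj_resolving_function G g \<longleftrightarrow> (\<forall>v\<in>verts G. 0 \<le> g v \<and> g v \<le> 1) \<and>
     (\<forall>u\<in>verts G. \<forall>v\<in>verts G. u \<noteq> v \<longrightarrow> 1 \<le> sum g (adj_res_set G u v))"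

lemma resolving_set_subset_verts: "resolving_set G u v \<subseteq> verts G"
  by (auto simp: resolving_set_def)

lemma resolving_set_commute: "resolving_set G u v = resolving_set G v u"
  by (auto simp: resolving_set_def)

lemma adj_resolving_function_resolves:
  assumes G: "simple_graph G" and g: "adj_resolving_function G g"
  shows "resolving_function G g" "resolving_function (complement G) g"
proof -
  have bounds: "0 \<le> g v" "g v \<le> 1" if "v \<in> verts G" for v
    using g that by (simp_all add: adj_resolving_function_def)
  have sum: "1 \<le> sum g (adj_res_set G u v)" if "u \<in> verts G" "v \<in> verts G" "u \<noteq> v" for u v
    using g that by (simp add: adj_resolving_function_def)
  have *: "1 \<le> sum g (resolving_set H u v)"
    if H: "simple_graph H" "verts H = verts G" and uv: "u \<in> verts G" "v \<in> verts G" "u \<noteq> v"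
      and same: "adj_res_set H u v = adj_res_set G u v" for H u v
  proof (rule sum_mono_superset)
    show "finite (resolving_set H u v)"
      using finite_subset[OF resolving_set_subset_verts finite_verts[OF H(1)]] .
    show "adj_res_set G u v \<subseteq> resolving_set H u v"
      using adj_res_set_subset[OF H(1), of u v] H(2) uv same by simp
    show "0 \<le> g z" if "z \<in> resolving_set H u v" for z
      using bounds(1) H(2) resolving_set_subset_verts[of H u v] that by blast
  qed (rule sum[OF uv])
  show "resolving_function G g"
    unfolding resolving_function_def using bounds *[OF G refl] by blast
  show "resolving_function (complement G) g"
    unfolding resolving_function_def verts_complement
    using bounds *[OF simple_graph_complement[OF G] verts_complement] adj_res_set_complement[OF G]
    by blast
qed

lemma Sd_f_eqI:
  assumes "resolving_function G g" "resolving_function H g" "sum g (verts G) = r"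
    and "\<And>h. resolving_function G h \<Longrightarrow> resolving_function H h \<Longrightarrow> r \<le> sum h (verts G)"
  shows "Sd_f G H = r"
  unfolding Sd_f_def using assms by (intro Least_equality) auto

lemma dim_f_eqI:
  assumes "resolving_function G g" "sum g (verts G) = r"
    and "\<And>h. resolving_function G h \<Longrightarrow> r \<le> sum h (verts G)"
  shows "dim_f G = r"
  unfolding dim_f_def using assms by (intro Least_equality) auto

text \<open>
  A function that resolves by adjacency resolves both graphs. If its weight is also a lower bound for
  the complement alone, it is optimal for both problems at once.
\<close>

lemma Sd_f_eq_dim_f_complement:
  assumes "simple_graph G" "adj_resolving_function G g" "sum g (verts G) = r"
    and "\<And>h. resolving_function (complement G) h \<Longrightarrow> r \<le> sum h (verts G)"
  shows "Sd_f G (complement G) = dim_f (complement G)"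
  using Sd_f_eqI[of G g "complement G" r] dim_f_eqI[of "complement G" g r]
    adj_resolving_function_resolves[OF assms(1,2)] assms by simp

lemma Sd_f_eq_dim_f:
  assumes "simple_graph G" "adj_resolving_function G g" "sum g (verts G) = r"
    and "\<And>h. resolving_function G h \<Longrightarrow> r \<le> sum h (verts G)"
  shows "Sd_f G (complement G) = r" "dim_f G = r"
  using Sd_f_eqI[of G g "complement G" r] dim_f_eqI[of G g r]
    adj_resolving_function_resolves[OF assms(1,2)] assms by simp_all

text \<open>
  Without dominating edges the complement has diameter at most two, so it resolves by adjacency and
  nothing else; an optimal function for the complement then resolves the graph as well.
\<close>

lemma Sd_f_eq_if_no_dominating_edge:
  assumes G: "simple_graph G" and none: "\<And>u v. \<not> dominating_edge G u v"
  shows "Sd_f G (complement G) = dim_f (complement G)"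
proof -
  obtain g where g: "resolving_function (complement G) g"
    and min: "\<And>h. resolving_function (complement G) h \<Longrightarrow> sum g (verts G) \<le> sum h (verts G)"
    using dim_f_attained[OF simple_graph_complement[OF G]] by auto
  have eq: "resolving_set (complement G) u v = adj_res_set G u v"
    if "u \<in> verts G" "v \<in> verts G" "u \<noteq> v" for u v
    using resolving_set_complement_subset[OF G that(1,2)]
      adj_res_set_subset[OF simple_graph_complement[OF G], of u v] adj_res_set_complement[OF G that(1,2)]
      that none by auto
  have "adj_resolving_function G g"
    using g eq by (auto simp: adj_resolving_function_def resolving_function_def)
  then show ?thesis using Sd_f_eq_dim_f_complement[OF G _ refl min] by blast
qed

definition uniform_on :: "nat \<Rightarrow> 'a set \<Rightarrow> 'a \<Rightarrow> real" where
  "uniform_on k H v = (if v \<in> H then 1 / k else 0)"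

lemma sum_uniform_on: "finite S \<Longrightarrow> sum (uniform_on k H) S = card (H \<inter> S) / k"
  by (simp add: uniform_on_def sum.If_cases Int_commute)

lemma uniform_on_bounds: "0 \<le> uniform_on k H v" "uniform_on k H v \<le> 1"
  by (auto simp: uniform_on_def divide_le_eq)

lemma card_ge_2I: "finite H \<Longrightarrow> p \<in> H \<Longrightarrow> q \<in> H \<Longrightarrow> p \<noteq> q \<Longrightarrow> 2 \<le> card H"
  using card_mono[of H "{p, q}"] by simp

lemma card_ge_3I:
  "finite H \<Longrightarrow> p \<in> H \<Longrightarrow> q \<in> H \<Longrightarrow> r \<in> H \<Longrightarrow> p \<noteq> q \<Longrightarrow> p \<noteq> r \<Longrightarrow> q \<noteq> r \<Longrightarrow> 3 \<le> card H"
  using card_mono[of H "{p, q, r}"] by simp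

lemma finite_nbhd: "simple_graph G \<Longrightarrow> finite (nbhd G v)"
  by (rule finite_subset[OF nbhd_subset_verts finite_verts])

lemma finite_adj_res_set: "simple_graph G \<Longrightarrow> finite (adj_res_set G u v)"
  by (simp add: adj_res_set_def finite_nbhd)

lemma finite_resolving_set: "simple_graph G \<Longrightarrow> finite (resolving_set G u v)"
  by (rule finite_subset[OF resolving_set_subset_verts finite_verts])

lemma uniform_on_resolving:
  assumes "simple_graph G" "0 < k"
    and "\<And>u v. u \<in> verts G \<Longrightarrow> v \<in> verts G \<Longrightarrow> u \<noteq> v \<Longrightarrow> k \<le> card (H \<inter> resolving_set G u v)"
  shows "resolving_function G (uniform_on k H)"
  using assms by (auto simp: resolving_function_def uniform_on_bounds sum_uniform_on finite_resolving_set)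

lemma twoI:
  "p \<noteq> q \<Longrightarrow> p \<in> H \<Longrightarrow> q \<in> H \<Longrightarrow> p \<in> S \<Longrightarrow> q \<in> S \<Longrightarrow> \<exists>p q. p \<noteq> q \<and> {p, q} \<subseteq> H \<inter> S"
  by blast

lemma two_elements:
  assumes "2 \<le> card T" "t \<in> T"
  obtains s where "s \<in> T" "s \<noteq> t"
proof -
  have "T \<noteq> {t}" using assms(1) by auto
  then show ?thesis using assms(2) that by blast
qed

text \<open>
  With weight one half on \<open>H\<close>, a resolving set weighs at least one once it meets \<open>H\<close> twice. Two
  vertices of \<open>H\<close> resolve each other with that weight already, so only pairs with a vertex outside
  \<open>H\<close> have to be inspected; \<open>R\<close> will be a family of resolving sets of either kind.
\<close>

lemma half_set_meets_twice:
  assumes "\<And>u v. finite (R u v)" "\<And>u v. R u v = R v u"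
    and own: "\<And>u v. u \<in> V \<Longrightarrow> v \<in> V \<Longrightarrow> u \<noteq> v \<Longrightarrow> {u, v} \<subseteq> R u v"
    and two: "\<And>u v. u \<in> V - H \<Longrightarrow> v \<in> V \<Longrightarrow> u \<noteq> v \<Longrightarrow>
      \<exists>p q. p \<noteq> q \<and> {p, q} \<subseteq> H \<inter> R u v"
    and uv: "u \<in> V" "v \<in> V" "u \<noteq> v"
  shows "2 \<le> card (H \<inter> R u v)"
proof -
  have "\<exists>p q. p \<noteq> q \<and> {p, q} \<subseteq> H \<inter> R u v"
  proof (cases "u \<in> H \<and> v \<in> H")
    case True
    then show ?thesis using uv own[OF uv] by blast
  next
    case False
    then show ?thesis using two[of u v] two[of v u] uv assms(2)[of u v] by fastforce
  qed
  then show ?thesis using card_ge_2I[of "H \<inter> R u v"] assms(1)[of u v] by blast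
qed

lemma half_on_adj_resolving:
  assumes G: "simple_graph G"
    and two: "\<And>u v. u \<in> verts G - H \<Longrightarrow> v \<in> verts G \<Longrightarrow> u \<noteq> v \<Longrightarrow>
      \<exists>p q. p \<noteq> q \<and> {p, q} \<subseteq> H \<inter> adj_res_set G u v"
  shows "adj_resolving_function G (uniform_on 2 H)"
proof -
  have "2 \<le> card (H \<inter> adj_res_set G u v)" if "u \<in> verts G" "v \<in> verts G" "u \<noteq> v" for u v
  proof (rule half_set_meets_twice[where R = "adj_res_set G", OF finite_adj_res_set[OF G]
        adj_res_set_commute _ two that])
  qed (auto simp: adj_res_set_def)
  then show ?thesis
    using G by (auto simp: adj_resolving_function_def uniform_on_bounds sum_uniform_on finite_adj_res_set)
qed

lemma half_on_resolving:
  assumes G: "simple_graph G"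
    and two: "\<And>u v. u \<in> verts G - H \<Longrightarrow> v \<in> verts G \<Longrightarrow> u \<noteq> v \<Longrightarrow>
      \<exists>p q. p \<noteq> q \<and> {p, q} \<subseteq> H \<inter> resolving_set G u v"
  shows "resolving_function G (uniform_on 2 H)"
proof (rule uniform_on_resolving[OF G])
  fix u v assume uv: "u \<in> verts G" "v \<in> verts G" "u \<noteq> v"
  show "2 \<le> card (H \<inter> resolving_set G u v)"
  proof (rule half_set_meets_twice[where R = "resolving_set G", OF finite_resolving_set[OF G]
        resolving_set_commute _ two uv])
  qed (use adj_res_set_subset[OF G] in \<open>auto simp: adj_res_set_def\<close>)
qed simp

lemma Sd_f_eq_by_half_set:
  assumes G: "simple_graph G" and H: "H \<subseteq> verts G"
    and two: "\<And>u v. u \<in> verts G - H \<Longrightarrow> v \<in> verts G \<Longrightarrow> u \<noteq> v \<Longrightarrow>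
      \<exists>p q. p \<noteq> q \<and> {p, q} \<subseteq> H \<inter> adj_res_set G u v"
    and "\<And>h. resolving_function (complement G) h \<Longrightarrow> card H / 2 \<le> sum h (verts G)"
  shows "Sd_f G (complement G) = dim_f (complement G)"
  using Sd_f_eq_dim_f_complement[OF G half_on_adj_resolving[OF G two], of "card H / 2"]
    assms(4) H finite_verts[OF G] by (simp add: sum_uniform_on Int_absorb2)

section \<open>Lower bounds from pairs with small resolving sets\<close>

lemma resolving_function_nonneg: "resolving_function G h \<Longrightarrow> v \<in> verts G \<Longrightarrow> 0 \<le> h v"
  by (simp add: resolving_function_def)

lemma resolving_function_pair:
  assumes "simple_graph G" "resolving_function G h" "u \<in> verts G" "v \<in> verts G" "u \<noteq> v"
    and "D \<subseteq> verts G" "resolving_set G u v \<subseteq> D"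
  shows "1 \<le> sum h D"
proof (rule sum_mono_superset)
  show "finite D" using assms finite_verts finite_subset by blast
  show "1 \<le> sum h (resolving_set G u v)" using assms by (simp add: resolving_function_def)
  show "0 \<le> h z" if "z \<in> D" for z
    using that assms(6) resolving_function_nonneg[OF assms(2)] by blast
qed (rule assms(7))

text \<open>
  The set \<open>D\<close> contains every vertex that resolves the pair in the complement, provided that a common
  neighbour left out of \<open>D\<close> reaches neither vertex of the pair along a dominating edge.
\<close>

lemma complement_pair:
  assumes "simple_graph G" "resolving_function (complement G) h"
    and "u \<in> verts G" "v \<in> verts G" "u \<noteq> v"
    and "D \<subseteq> verts G" "adj_res_set G u v \<subseteq> D"
    and "\<And>z. z \<in> nbhd G u \<Longrightarrow> z \<in> nbhd G v \<Longrightarrow> z \<notin> D \<Longrightarrow>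
      \<not> verts G \<subseteq> nbhd G u \<union> nbhd G z \<and> \<not> verts G \<subseteq> nbhd G v \<union> nbhd G z"
  shows "1 \<le> sum h D"
proof (rule resolving_function_pair[of "complement G" h u v])
  show "resolving_set (complement G) u v \<subseteq> D"
  proof
    fix z assume "z \<in> resolving_set (complement G) u v"
    then consider "z \<in> adj_res_set G u v"
      | "z \<in> nbhd G u" "z \<in> nbhd G v" "dominating_edge G u z \<or> dominating_edge G v z"
      using resolving_set_complement_subset[OF assms(1,3,4)] by blast
    then show "z \<in> D"
    proof cases
      case 1
      then show ?thesis using assms(7) by blast
    next
      case 2
      then show ?thesis using assms(8)[of z] unfolding dominating_edge_def by blast
    qed
  qed
qed (use assms in \<open>simp_all add: simple_graph_complement\<close>)

lemma complement_pair_list: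
  assumes "simple_graph G" "resolving_function (complement G) h"
    and "u \<in> verts G" "v \<in> verts G" "u \<noteq> v"
    and "distinct ds" "set ds \<subseteq> verts G" "adj_res_set G u v \<subseteq> set ds"
    and "\<And>z. z \<in> nbhd G u \<Longrightarrow> z \<in> nbhd G v \<Longrightarrow> z \<notin> set ds \<Longrightarrow>
      \<not> verts G \<subseteq> nbhd G u \<union> nbhd G z \<and> \<not> verts G \<subseteq> nbhd G v \<union> nbhd G z"
  shows "1 \<le> sum_list (map h ds)"
  using complement_pair[OF assms(1-5,7-9)] sum_list_distinct_conv_sum_set[OF assms(6), of h] by simp

lemma twin_pair:
  assumes "simple_graph G" "resolving_function G h"
    and "u \<in> verts G" "v \<in> verts G" "u \<noteq> v" "nbhd G u - {v} = nbhd G v - {u}"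
  shows "1 \<le> h u + h v"
  using resolving_function_pair[OF assms(1-5), of "{u, v}"]
    twins_resolving_set[OF assms(1,3,4,6)] assms by simp

lemma complement_twin_pair:
  assumes "simple_graph G" "resolving_function (complement G) h"
    and "u \<in> verts G" "v \<in> verts G" "u \<noteq> v" "nbhd G u - {v} = nbhd G v - {u}"
  shows "1 \<le> h u + h v"
proof (rule twin_pair[of "complement G"])
  show "nbhd (complement G) u - {v} = nbhd (complement G) v - {u}"
    using assms by (auto simp: nbhd_complement)
qed (use assms in \<open>simp_all add: simple_graph_complement\<close>)

text \<open>
  If some value is less than one half, all other values are more than one half, and any one of them
  makes up for it. A single value has no partner, so a one-element \<open>T\<close> is excluded.
\<close>

lemma half_card_le_sum:
  fixes f :: "'a \<Rightarrow> real"
  assumes "finite T" "card T \<noteq> 1"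
    and pair: "\<And>s t. s \<in> T \<Longrightarrow> t \<in> T \<Longrightarrow> s \<noteq> t \<Longrightarrow> 1 \<le> f s + f t"
  shows "card T / 2 \<le> sum f T"
proof (cases "\<forall>t\<in>T. 1 / 2 \<le> f t")
  case True
  then show ?thesis using sum_mono[of T "\<lambda>_. 1 / 2" f] by simp
next
  case False
  then obtain s where s: "s \<in> T" "f s < 1 / 2" by auto
  then have "T - {s} \<noteq> {}" using assms(1,2) by (metis card_1_singleton_iff One_nat_def insert_Diff)
  then obtain t where t: "t \<in> T" "t \<noteq> s" by auto
  let ?U = "T - {s} - {t}"
  have "1 / 2 \<le> f r" if "r \<in> ?U" for r using pair[of s r] s that by auto
  then have "card ?U / 2 \<le> sum f ?U" using sum_mono[of ?U "\<lambda>_. 1 / 2" f] by simp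
  moreover have "sum f T = f s + (f t + sum f ?U)"
    using assms(1) s(1) t by (simp add: sum.remove[of T s] sum.remove[of "T - {s}" t])
  moreover have "card T = card ?U + 2"
    using assms(1) s(1) t card_ge_2I[of T s t] by (simp add: card_Diff_singleton)
  ultimately show ?thesis using pair[OF s(1) t(1)] t(2) by auto
qed

text \<open>
  The number \<open>c\<close>, usually a sum of several weights, acts as the value of an additional element.
\<close>

lemma half_card_le_sum_extra:
  fixes f :: "'a \<Rightarrow> real"
  assumes "finite T" "T \<noteq> {}"
    and pair: "\<And>s t. s \<in> T \<Longrightarrow> t \<in> T \<Longrightarrow> s \<noteq> t \<Longrightarrow> 1 \<le> f s + f t"
    and extra: "\<And>t. t \<in> T \<Longrightarrow> 1 \<le> c + f t"
  shows "(card T + 1) / 2 \<le> c + sum f T"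
proof -
  have extra': "1 \<le> f t + c" if "t \<in> T" for t
    using extra[OF that] by simp
  let ?f = "\<lambda>s. case s of None \<Rightarrow> c | Some t \<Rightarrow> f t"
  have "card (insert None (Some ` T)) / 2 \<le> sum ?f (insert None (Some ` T))"
  proof (rule half_card_le_sum)
    show "card (insert None (Some ` T)) \<noteq> 1"
      using assms(1,2) by (simp add: card_image card_gt_0_iff)
    show "1 \<le> ?f s + ?f t" if "s \<in> insert None (Some ` T)" "t \<in> insert None (Some ` T)" "s \<noteq> t" for s t
      using that pair extra extra' by (cases s; cases t) auto
  qed (use assms(1) in simp)
  then show ?thesis using assms(1) by (simp add: card_image sum.reindex add.commute)
qed

lemma half_card_le_sum_complement_twins:
  assumes G: "simple_graph G" "resolving_function (complement G) h"
    and T: "finite T" "T \<subseteq> verts G" "card T \<noteq> 1" "\<And>l. l \<in> T \<Longrightarrow> nbhd G l = N"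
  shows "card T / 2 \<le> sum h T"
proof (rule half_card_le_sum[OF T(1,3)])
  fix s t assume "s \<in> T" "t \<in> T" "s \<noteq> t"
  moreover from this have "nbhd G s = N" "nbhd G t = N" using T(4) by blast+
  moreover from this have "s \<notin> N" "t \<notin> N" using not_in_own_nbhd[OF G(1)] by blast+
  ultimately show "1 \<le> h s + h t"
    using T(2) by (intro complement_twin_pair[OF G]) auto
qed

section \<open>Unicyclic graphs with a dominating edge\<close>

lemma edges_cycle_graph: "edges (cycle_graph n) = (\<lambda>i. {i, Suc i mod n}) ` {..<n}"
  by (auto simp: cycle_graph_def)

lemma cycle_graph_3: "cycle_graph 3 = ({0, 1, 2}, {{0, 1}, {1, 2}, {2, 0}})"
proof -
  have "{..<3} = {0, 1, 2::nat}" by auto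
  then show ?thesis
    using edges_cycle_graph[of 3]
    by (intro prod_eqI) (simp_all add: cycle_graph_def numeral_2_eq_2[symmetric] numeral_3_eq_3[symmetric])
qed

lemma cycle_graph_4: "cycle_graph 4 = ({0, 1, 2, 3}, {{0, 1}, {1, 2}, {2, 3}, {3, 0}})"
proof -
  have "{..<4} = {0, 1, 2, 3::nat}" by auto
  then show ?thesis
    using edges_cycle_graph[of 4]
    by (intro prod_eqI) (simp_all add: cycle_graph_def numeral_2_eq_2[symmetric] numeral_3_eq_3[symmetric])
qed

lemma triangle_cycle:
  assumes G: "simple_graph G" and d: "distinct [p, q, r]"
    and e: "q \<in> nbhd G p" "r \<in> nbhd G q" "p \<in> nbhd G r"
  shows "\<exists>C. cycle_of G C \<and> verts C = {p, q, r}"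
proof (intro exI conjI)
  let ?C = "({p, q, r}, {{p, q}, {q, r}, {r, p}})"
  let ?f = "\<lambda>v. if v = p then 0 else if v = q then 1 else (2::nat)"
  have "{p, q, r} \<subseteq> verts G" using e nbhd_subset_verts[OF G] by blast
  then have "subgraph ?C G"
    using e d by (auto simp: subgraph_def simple_graph_def nbhd_def)
  moreover have "isomorphic ?C (cycle_graph 3)"
    unfolding isomorphic_def
  proof (intro exI conjI)
    show "bij_betw ?f (verts ?C) (verts (cycle_graph 3))"
      using d by (auto simp: bij_betw_def inj_on_def cycle_graph_3)
    show "\<forall>x\<in>verts ?C. \<forall>y\<in>verts ?C. {x, y} \<in> edges ?C \<longleftrightarrow> {?f x, ?f y} \<in> edges (cycle_graph 3)"
      using d by (auto simp: cycle_graph_3 doubleton_eq_iff)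
  qed
  ultimately show "cycle_of G ?C" by (auto simp: cycle_of_def)
qed simp

lemma square_cycle:
  assumes G: "simple_graph G" and d: "distinct [p, q, r, s]"
    and e: "q \<in> nbhd G p" "r \<in> nbhd G q" "s \<in> nbhd G r" "p \<in> nbhd G s"
  shows "\<exists>C. cycle_of G C \<and> verts C = {p, q, r, s}"
proof (intro exI conjI)
  let ?C = "({p, q, r, s}, {{p, q}, {q, r}, {r, s}, {s, p}})"
  let ?f = "\<lambda>v. if v = p then 0 else if v = q then 1 else if v = r then 2 else (3::nat)"
  have "{p, q, r, s} \<subseteq> verts G" using e nbhd_subset_verts[OF G] by blast
  then have "subgraph ?C G"
    using e d by (auto simp: subgraph_def simple_graph_def nbhd_def)
  moreover have "isomorphic ?C (cycle_graph 4)"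
    unfolding isomorphic_def
  proof (intro exI conjI)
    show "bij_betw ?f (verts ?C) (verts (cycle_graph 4))"
      using d by (auto simp: bij_betw_def inj_on_def cycle_graph_4)
    show "\<forall>x\<in>verts ?C. \<forall>y\<in>verts ?C. {x, y} \<in> edges ?C \<longleftrightarrow> {?f x, ?f y} \<in> edges (cycle_graph 4)"
      using d by (auto simp: cycle_graph_4 doubleton_eq_iff)
  qed
  ultimately show "cycle_of G ?C" by (auto simp: cycle_of_def intro: exI[of _ 4])
qed simp

lemma cycle_vertex_two_neighbours:
  assumes "cycle_of G C" "v \<in> verts C"
  shows "\<exists>s t. s \<noteq> t \<and> s \<in> nbhd G v \<and> t \<in> nbhd G v"
proof -
  obtain n f where n: "n \<ge> 3" and f: "bij_betw f (verts C) {..<n}"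
    and e: "\<And>x y. x \<in> verts C \<Longrightarrow> y \<in> verts C \<Longrightarrow>
      {x, y} \<in> edges C \<longleftrightarrow> {f x, f y} \<in> edges (cycle_graph n)"
    and sub: "edges C \<subseteq> edges G"
    using assms(1) by (auto simp: cycle_of_def subgraph_def isomorphic_def cycle_graph_def)
  define i where "i = f v"
  have i: "i < n" using f assms(2) by (auto simp: i_def bij_betw_def)
  define j where "j = Suc i mod n"
  define k where "k = (if i = 0 then n - 1 else i - 1)"
  have k: "Suc k mod n = i" "k < n" using i n by (auto simp: k_def)
  have j: "j < n" using n by (simp add: j_def)
  have "j \<noteq> k"
  proof (cases "Suc i < n")
    case True
    then show ?thesis using n by (auto simp: j_def k_def)
  next
    case False
    then have "Suc i = n" using i by simp
    then show ?thesis using n by (auto simp: j_def k_def)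
  qed
  have "{i, j} \<in> edges (cycle_graph n)" "{i, k} \<in> edges (cycle_graph n)"
    using i k by (auto simp: cycle_graph_def j_def insert_commute)
  moreover have "j \<in> f ` verts C" "k \<in> f ` verts C"
    using f j k(2) by (simp_all add: bij_betw_def)
  then obtain s t where st: "s \<in> verts C" "t \<in> verts C" "f s = j" "f t = k" by blast
  ultimately have "{v, s} \<in> edges C" "{v, t} \<in> edges C"
    using e assms(2) by (auto simp: i_def)
  then have "s \<in> nbhd G v" "t \<in> nbhd G v"
    using sub by (simp_all add: nbhd_def subsetD)
  moreover have "s \<noteq> t" using st(3,4) \<open>j \<noteq> k\<close> by auto
  ultimately show ?thesis by blast
qed

lemma cycle_not_in_pair:
  assumes "cycle_of G C"
  shows "\<exists>v\<in>verts C. v \<notin> {x, y}"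
proof (rule ccontr)
  assume "\<not> ?thesis"
  then have "verts C \<subseteq> {x, y}" by blast
  then have "card (verts C) \<le> 2" using card_mono[of "{x, y}" "verts C"] card_insert_le_m1[of 2 "{y}" x]
    by (simp add: card_insert_if split: if_splits)
  moreover have "card (verts C) \<ge> 3"
    using assms by (auto simp: cycle_of_def isomorphic_def cycle_graph_def dest: bij_betw_same_card)
  ultimately show False by simp
qed

text \<open>
  Relative to a dominating edge \<open>xy\<close>, the spine, a unicyclic graph is a double star with centres \<open>x\<close> and
  \<open>y\<close> plus one edge, and the three locales tell where this edge closes the cycle: at a vertex \<open>w\<close>
  adjacent to both centres, between two neighbours \<open>v\<close>, \<open>w\<close> of \<open>x\<close>, or between a neighbour \<open>x'\<close> of
  \<open>x\<close> and a neighbour \<open>y'\<close> of \<open>y\<close>. The leaves at \<open>x\<close> and \<open>y\<close> form \<open>A\<close> and \<open>B\<close>; either set may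
  be empty.
\<close>

locale spine_triangle =
  fixes G :: "'a graph" and x y w :: 'a and A B :: "'a set"
  assumes simple: "simple_graph G"
    and verts: "verts G = {x, y, w} \<union> A \<union> B"
    and distinct: "distinct [x, y, w]" "{x, y, w} \<inter> (A \<union> B) = {}" "A \<inter> B = {}"
    and nbhd_x: "nbhd G x = {y, w} \<union> A" and nbhd_y: "nbhd G y = {x, w} \<union> B"
    and nbhd_w: "nbhd G w = {x, y}"
    and nbhd_A: "\<And>l. l \<in> A \<Longrightarrow> nbhd G l = {x}"
    and nbhd_B: "\<And>m. m \<in> B \<Longrightarrow> nbhd G m = {y}"

locale side_triangle =
  fixes G :: "'a graph" and x y v w :: 'a and A B :: "'a set"
  assumes simple: "simple_graph G"
    and verts: "verts G = {x, y, v, w} \<union> A \<union> B"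
    and distinct: "distinct [x, y, v, w]" "{x, y, v, w} \<inter> (A \<union> B) = {}" "A \<inter> B = {}"
    and nbhd_x: "nbhd G x = {y, v, w} \<union> A" and nbhd_y: "nbhd G y = {x} \<union> B"
    and nbhd_v: "nbhd G v = {x, w}" and nbhd_w: "nbhd G w = {x, v}"
    and nbhd_A: "\<And>l. l \<in> A \<Longrightarrow> nbhd G l = {x}"
    and nbhd_B: "\<And>m. m \<in> B \<Longrightarrow> nbhd G m = {y}"

locale spine_square =
  fixes G :: "'a graph" and x y x' y' :: 'a and A B :: "'a set"
  assumes simple: "simple_graph G"
    and verts: "verts G = {x, y, x', y'} \<union> A \<union> B"
    and distinct: "distinct [x, y, x', y']" "{x, y, x', y'} \<inter> (A \<union> B) = {}" "A \<inter> B = {}"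
    and nbhd_x: "nbhd G x = {y, x'} \<union> A" and nbhd_y: "nbhd G y = {x, y'} \<union> B"
    and nbhd_x': "nbhd G x' = {x, y'}" and nbhd_y': "nbhd G y' = {y, x'}"
    and nbhd_A: "\<And>l. l \<in> A \<Longrightarrow> nbhd G l = {x}"
    and nbhd_B: "\<And>m. m \<in> B \<Longrightarrow> nbhd G m = {y}"

text \<open>
  A vertex \<open>w\<close> adjacent to both \<open>x\<close> and \<open>y\<close> closes a triangle whose only vertex off the spine is
  \<open>w\<close>, and an edge \<open>ab\<close> off the spine closes a triangle or a square whose vertices off the spine
  are \<open>a\<close> and \<open>b\<close>. Hence the vertex set of the unique cycle determines which of these occurs, and it
  occurs once. Something of this kind does occur: the cycle has a vertex off the spine, and unless this
  vertex is adjacent to both \<open>x\<close> and \<open>y\<close>, one of its two neighbours on the cycle is off the spine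
  as well.
\<close>

lemma unicyclic_dominating_edge_cases:
  assumes uni: "unicyclic G" and dom: "dominating_edge G x y"
  obtains w A B where "spine_triangle G x y w A B"
  | v w A B where "side_triangle G x y v w A B"
  | v w A B where "side_triangle G y x v w A B"
  | x' y' A B where "spine_square G x y x' y' A B"
proof -
  have G: "simple_graph G" using uni by (simp add: unicyclic_def)
  obtain C where C: "cycle_of G C" and unique: "\<And>C'. cycle_of G C' \<Longrightarrow> C' = C"
    using uni by (auto simp: unicyclic_def)
  have sym: "a \<in> nbhd G b" if "b \<in> nbhd G a" for a b using that nbhd_sym by fast
  have irrefl: "a \<notin> nbhd G a" for a by (rule not_in_own_nbhd[OF G])
  have sub: "a \<in> verts G" if "a \<in> nbhd G b" for a b using that nbhd_subset_verts[OF G] by blast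
  have xy: "y \<in> nbhd G x" "x \<in> nbhd G y" "x \<noteq> y"
    using dom sym irrefl by (auto simp: dominating_edge_def)
  have cover: "a \<in> nbhd G x \<or> a \<in> nbhd G y" if "a \<in> verts G" for a
    using dom that by (auto simp: dominating_edge_def)
  have spine: "verts C - {x, y} = {w}" if "w \<in> nbhd G x" "w \<in> nbhd G y" for w
  proof -
    have "distinct [x, y, w]" using that irrefl xy by auto
    then show ?thesis using triangle_cycle[OF G, of x y w] that xy sym unique by fastforce
  qed
  have chord: "verts C - {x, y} = {a, b}"
    if ab: "b \<in> nbhd G a" "a \<notin> {x, y}" "b \<notin> {x, y}" for a b
  proof -
    have "a \<noteq> b" using ab irrefl by auto
    consider "a \<in> nbhd G x" "b \<in> nbhd G x" | "a \<in> nbhd G y" "b \<in> nbhd G y"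
      | "a \<in> nbhd G x" "b \<in> nbhd G y" | "a \<in> nbhd G y" "b \<in> nbhd G x"
      using cover sub ab(1) sym by blast
    then show ?thesis
    proof cases
      case 1
      then have "\<exists>C. cycle_of G C \<and> verts C = {x, a, b}"
        using \<open>a \<noteq> b\<close> ab sym by (intro triangle_cycle[OF G]) auto
      then show ?thesis using unique ab by fastforce
    next
      case 2
      then have "\<exists>C. cycle_of G C \<and> verts C = {y, a, b}"
        using \<open>a \<noteq> b\<close> ab sym by (intro triangle_cycle[OF G]) auto
      then show ?thesis using unique ab by fastforce
    next
      case 3
      then have "\<exists>C. cycle_of G C \<and> verts C = {x, a, b, y}"
        using \<open>a \<noteq> b\<close> ab sym xy by (intro square_cycle[OF G]) auto
      then show ?thesis using unique ab by fastforce
    next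
      case 4
      then have "\<exists>C. cycle_of G C \<and> verts C = {y, a, b, x}"
        using \<open>a \<noteq> b\<close> ab sym xy by (intro square_cycle[OF G]) auto
      then show ?thesis using unique ab by fastforce
    qed
  qed
  show ?thesis
  proof (cases "\<exists>w. w \<in> nbhd G x \<and> w \<in> nbhd G y")
    case True
    then obtain w where w: "w \<in> nbhd G x" "w \<in> nbhd G y" by blast
    have X: "verts C - {x, y} = {w}" by (rule spine[OF w])
    have spine_w: "a = w" if "a \<in> nbhd G x" "a \<in> nbhd G y" for a
      using spine[OF that] X by simp
    have no_chord: "a \<in> {x, y} \<or> b \<in> {x, y}" if "b \<in> nbhd G a" for a b
      using chord[OF that] X that irrefl by (metis doubleton_eq_iff insert_absorb2)
    have "spine_triangle G x y w (nbhd G x - {y, w}) (nbhd G y - {x, w})"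
    proof
      show "verts G = {x, y, w} \<union> (nbhd G x - {y, w}) \<union> (nbhd G y - {x, w})"
        using cover sub xy w by blast
      show "distinct [x, y, w]" using w xy irrefl by auto
      show "{x, y, w} \<inter> (nbhd G x - {y, w} \<union> (nbhd G y - {x, w})) = {}" using irrefl by auto
      show "(nbhd G x - {y, w}) \<inter> (nbhd G y - {x, w}) = {}" using spine_w by auto
      show "nbhd G x = {y, w} \<union> (nbhd G x - {y, w})" using xy w by auto
      show "nbhd G y = {x, w} \<union> (nbhd G y - {x, w})" using xy w by auto
      show "nbhd G w = {x, y}" using no_chord[of _ w] w sym irrefl by blast
      show "nbhd G l = {x}" if "l \<in> nbhd G x - {y, w}" for l
        using no_chord[of _ l] that sym irrefl spine_w by blast
      show "nbhd G m = {y}" if "m \<in> nbhd G y - {x, w}" for m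
        using no_chord[of _ m] that sym irrefl spine_w by blast
    qed (rule G)
    then show ?thesis by (rule that(1))
  next
    case False
    then have disj: "\<not> (a \<in> nbhd G x \<and> a \<in> nbhd G y)" for a by blast
    obtain a where a: "a \<in> verts C" "a \<notin> {x, y}" using cycle_not_in_pair[OF C] by blast
    obtain s t where st: "s \<noteq> t" "s \<in> nbhd G a" "t \<in> nbhd G a"
      using cycle_vertex_two_neighbours[OF C a(1)] by blast
    then obtain b where b: "b \<in> nbhd G a" "b \<notin> {x, y}"
      using disj[of a] sym by blast
    \<comment> \<open>By uniqueness of the cycle, \<open>ab\<close> is then the only edge that avoids both \<open>x\<close> and \<open>y\<close>.\<close>
    have X: "verts C - {x, y} = {a, b}" using chord b a by blast
    have chord_ab: "c \<in> {x, y} \<or> d \<in> {x, y} \<or> {c, d} = {a, b}" if "d \<in> nbhd G c" for c d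
      using chord[OF that] X by blast
    have ba: "a \<in> nbhd G b" by (rule sym[OF b(1)])
    have ne: "a \<noteq> b" "a \<noteq> x" "a \<noteq> y" "b \<noteq> x" "b \<noteq> y" using a b irrefl by auto
    have leaf: "nbhd G c \<subseteq> {x, y}" if "c \<notin> {x, y, a, b}" for c
      using chord_ab[of _ c] that by blast
    have nbhd_a: "nbhd G a \<subseteq> {x, y, b}"
      using chord_ab[of _ a] ne irrefl by (auto simp: doubleton_eq_iff)
    have nbhd_b: "nbhd G b \<subseteq> {x, y, a}"
      using chord_ab[of _ b] ne irrefl by (auto simp: doubleton_eq_iff)
    have side: "side_triangle G p q a b (nbhd G p - {q, a, b}) (nbhd G q - {p})"
      if pq: "{p, q} = {x, y}" and p: "a \<in> nbhd G p" "b \<in> nbhd G p" for p q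
    proof
      have pq': "p \<noteq> q" "q \<in> nbhd G p" "p \<in> nbhd G q"
        using pq xy by (auto simp: doubleton_eq_iff)
      have cov: "c \<in> nbhd G p \<or> c \<in> nbhd G q" if "c \<in> verts G" for c
        using pq cover[OF that] by (auto simp: doubleton_eq_iff)
      have disj': "\<not> (c \<in> nbhd G p \<and> c \<in> nbhd G q)" for c
        using pq disj by (auto simp: doubleton_eq_iff)
      have na: "nbhd G a \<subseteq> {p, q, b}" and nb: "nbhd G b \<subseteq> {p, q, a}"
        using nbhd_a nbhd_b pq by blast+
      have lf: "nbhd G c \<subseteq> {p, q}" if "c \<notin> {p, q, a, b}" for c
        using leaf[of c] that pq by blast
      show "verts G = {p, q, a, b} \<union> (nbhd G p - {q, a, b}) \<union> (nbhd G q - {p})"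
        using cov sub pq' p by blast
      have "a \<notin> {p, q}" "b \<notin> {p, q}" unfolding pq using ne by blast+
      then show "distinct [p, q, a, b]" using pq' ne by auto
      show "{p, q, a, b} \<inter> (nbhd G p - {q, a, b} \<union> (nbhd G q - {p})) = {}"
        using irrefl p disj' by auto
      show "(nbhd G p - {q, a, b}) \<inter> (nbhd G q - {p}) = {}" using disj' by auto
      show "nbhd G p = {q, a, b} \<union> (nbhd G p - {q, a, b})" using pq' p by auto
      show "nbhd G q = {p} \<union> (nbhd G q - {p})" using pq' by auto
      show "nbhd G a = {p, b}" using na p disj' sym b(1) by blast
      show "nbhd G b = {p, a}" using nb p disj' sym ba by blast
      show "nbhd G l = {p}" if "l \<in> nbhd G p - {q, a, b}" for l
        using lf[of l] that sym irrefl disj' by blast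
      show "nbhd G m = {q}" if "m \<in> nbhd G q - {p}" for m
        using lf[of m] that sym irrefl disj' p by blast
    qed (rule G)
    have square: "spine_square G x y c d (nbhd G x - {y, c}) (nbhd G y - {x, d})"
      if cd: "{c, d} = {a, b}" and p: "c \<in> nbhd G x" "d \<in> nbhd G y" for c d
    proof
      have cd': "c \<noteq> d" "d \<in> nbhd G c" "c \<in> nbhd G d" "c \<notin> {x, y}" "d \<notin> {x, y}"
        using cd ne b(1) ba by (auto simp: doubleton_eq_iff)
      have nc: "nbhd G c \<subseteq> {x, y, d}" and nd: "nbhd G d \<subseteq> {x, y, c}"
        using cd nbhd_a nbhd_b by (auto simp: doubleton_eq_iff)
      have lf: "nbhd G l \<subseteq> {x, y}" if "l \<notin> {x, y, c, d}" for l
        using leaf[of l] that cd by blast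
      show "verts G = {x, y, c, d} \<union> (nbhd G x - {y, c}) \<union> (nbhd G y - {x, d})"
        using cover sub xy p by blast
      show "distinct [x, y, c, d]" using cd' xy by auto
      show "{x, y, c, d} \<inter> (nbhd G x - {y, c} \<union> (nbhd G y - {x, d})) = {}"
        using irrefl p disj by auto
      show "(nbhd G x - {y, c}) \<inter> (nbhd G y - {x, d}) = {}" using disj by auto
      show "nbhd G x = {y, c} \<union> (nbhd G x - {y, c})" using xy p by auto
      show "nbhd G y = {x, d} \<union> (nbhd G y - {x, d})" using xy p by auto
      show "nbhd G c = {x, d}" using nc p disj sym cd'(2) by blast
      show "nbhd G d = {y, c}" using nd p disj sym cd'(3) by blast
      show "nbhd G l = {x}" if "l \<in> nbhd G x - {y, c}" for l
        using lf[of l] that sym irrefl disj p by blast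
      show "nbhd G m = {y}" if "m \<in> nbhd G y - {x, d}" for m
        using lf[of m] that sym irrefl disj p by blast
    qed (rule G)
    have "a \<in> nbhd G x \<or> a \<in> nbhd G y" "b \<in> nbhd G x \<or> b \<in> nbhd G y"
      using cover sub b(1) ba by blast+
    then consider "a \<in> nbhd G x" "b \<in> nbhd G x" | "a \<in> nbhd G y" "b \<in> nbhd G y"
      | "a \<in> nbhd G x" "b \<in> nbhd G y" | "b \<in> nbhd G x" "a \<in> nbhd G y"
      by blast
    then show ?thesis
    proof cases
      case 1
      then show ?thesis using side[of x y] that(2) by blast
    next
      case 2
      then show ?thesis using side[of y x] that(3) by blast
    next
      case 3
      then show ?thesis using square[of a b] that(4) by blast
    next
      case 4
      then show ?thesis using square[of b a] that(4) by blast
    qed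
  qed
qed

section \<open>The exceptional graphs\<close>

lemma isomorphic_if_nbhd:
  assumes G: "simple_graph G" and f: "bij_betw f (verts G) (verts H)"
    and nb: "\<And>v. v \<in> verts G \<Longrightarrow> nbhd H (f v) = f ` nbhd G v"
  shows "isomorphic G H"
  unfolding isomorphic_def
proof (intro exI conjI ballI)
  fix u v assume uv: "u \<in> verts G" "v \<in> verts G"
  have "v \<in> nbhd G u \<longleftrightarrow> f v \<in> f ` nbhd G u"
    using inj_on_image_mem_iff[OF bij_betw_imp_inj_on[OF f] uv(2) nbhd_subset_verts[OF G]] by blast
  then show "{u, v} \<in> edges G \<longleftrightarrow> {f u, f v} \<in> edges H"
    using nb[OF uv(1)] by (auto simp: nbhd_def)
qed (rule f)

lemma isomorphicE:
  assumes G: "simple_graph G" and H: "simple_graph H" and iso: "isomorphic G H"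
  obtains g where "bij_betw g (verts H) (verts G)"
    and "\<And>v. v \<in> verts H \<Longrightarrow> nbhd G (g v) = g ` nbhd H v"
proof -
  obtain f where f: "bij_betw f (verts G) (verts H)"
    and e: "\<And>u v. u \<in> verts G \<Longrightarrow> v \<in> verts G \<Longrightarrow> {u, v} \<in> edges G \<longleftrightarrow> {f u, f v} \<in> edges H"
    using iso by (auto simp: isomorphic_def)
  define g where "g = inv_into (verts G) f"
  have g: "bij_betw g (verts H) (verts G)" unfolding g_def by (rule bij_betw_inv_into[OF f])
  have fg: "f (g v) = v" if "v \<in> verts H" for v
    unfolding g_def using f that by (simp add: bij_betw_inv_into_right)
  have gf: "g (f u) = u" if "u \<in> verts G" for u
    unfolding g_def using f that by (simp add: bij_betw_inv_into_left)
  have gV: "g v \<in> verts G" if "v \<in> verts H" for v using g that by (auto simp: bij_betw_def)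
  have "nbhd G (g v) = g ` nbhd H v" if v: "v \<in> verts H" for v
  proof (intro set_eqI iffI)
    fix u assume u: "u \<in> nbhd G (g v)"
    then have uV: "u \<in> verts G" using nbhd_subset_verts[OF G] by blast
    then have "f u \<in> nbhd H v" using u e[OF gV[OF v] uV] fg[OF v] by (simp add: nbhd_def)
    then show "u \<in> g ` nbhd H v" using gf[OF uV] by force
  next
    fix u assume "u \<in> g ` nbhd H v"
    then obtain z where z: "z \<in> nbhd H v" "u = g z" by blast
    then have zV: "z \<in> verts H" using nbhd_subset_verts[OF H] by blast
    then show "u \<in> nbhd G (g v)"
      using z e[OF gV[OF v] gV[OF zV]] fg[OF v] fg[OF zV] by (simp add: nbhd_def)
  qed
  with g show ?thesis using that by blast
qed

lemma complete_graph_1: "complete_graph 1 = ({0}, {})"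
  by (auto simp: complete_graph_def lessThan_Suc subset_singleton_iff)

lemma H1_eq: "H1 = ({Inl 0, Inr 0, Inr 1, Inr 2},
    {{Inl 0, Inr 0}, {Inr 0, Inr 1}, {Inr 1, Inr 2}, {Inr 2, Inr 0}})"
  unfolding H1_def add_edge_def disjoint_union_def complete_graph_1 cycle_graph_3 by auto

lemma H2_eq: "H2 = ({Inl 0, Inr 0, Inr 1, Inr 2, Inr 3},
    {{Inl 0, Inr 0}, {Inr 0, Inr 1}, {Inr 1, Inr 2}, {Inr 2, Inr 3}, {Inr 3, Inr 0}})"
  unfolding H2_def add_edge_def disjoint_union_def complete_graph_1 cycle_graph_4 by auto

lemma H3_eq: "H3 = ({0, 1, 2, 3, 4, 5}, {{1, 4}, {0, 1}, {1, 2}, {2, 3}, {3, 4}, {4, 5}})"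
proof -
  have 5: "{..<5} = {0, 1, 2, 3, 4::nat}" and 6: "{..<6} = {0, 1, 2, 3, 4, 5::nat}" by auto
  have "{{i, Suc i} |i. Suc i < 6} = (\<lambda>i. {i, Suc i}) ` {..<5}" by auto
  also have "\<dots> = {{0, 1}, {1, 2}, {2, 3}, {3, 4}, {4, 5}}"
    unfolding 5 by (simp add: numeral_2_eq_2[symmetric])
  finally show ?thesis unfolding H3_def add_edge_def path_graph_def by (simp add: 6)
qed

lemma nbhd_H1:
  "nbhd H1 (Inl 0) = {Inr 0}"
  "nbhd H1 (Inr 0) = {Inr 1, Inr 2, Inl 0}"
  "nbhd H1 (Inr 1) = {Inr 0, Inr 2}"
  "nbhd H1 (Inr 2) = {Inr 0, Inr 1}"
  by (auto simp: nbhd_def H1_eq doubleton_eq_iff)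

lemma verts_H1: "verts H1 = {Inl 0, Inr 0, Inr 1, Inr 2}"
  by (simp add: H1_eq)

lemma isomorphic_H1_iff:
  assumes G: "simple_graph G"
  shows "isomorphic G H1 \<longleftrightarrow> (\<exists>x y w l. spine_triangle G x y w {l} {})"
proof
  have H: "simple_graph H1" by (auto simp: simple_graph_def H1_eq)
  assume "isomorphic G H1"
  then obtain g where g: "bij_betw g (verts H1) (verts G)"
    and nb: "\<And>v. v \<in> verts H1 \<Longrightarrow> nbhd G (g v) = g ` nbhd H1 v"
    using isomorphicE[OF G H] by blast
  have "nbhd G (g (Inl 0)) = {g (Inr 0)}"
    "nbhd G (g (Inr 0)) = {g (Inr 1), g (Inr 2), g (Inl 0)}"
    "nbhd G (g (Inr 1)) = {g (Inr 0), g (Inr 2)}"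
    "nbhd G (g (Inr 2)) = {g (Inr 0), g (Inr 1)}"
    using nb[of "Inl 0"] nb[of "Inr 0"] nb[of "Inr 1"] nb[of "Inr 2"] by (simp_all add: verts_H1 nbhd_H1 del: One_nat_def)
  moreover have "distinct [g (Inl 0), g (Inr 0), g (Inr 1), g (Inr 2)]"
    using bij_betw_imp_inj_on[OF g] by (simp add: verts_H1 inj_on_def del: One_nat_def)
  moreover have "verts G = {g (Inl 0), g (Inr 0), g (Inr 1), g (Inr 2)}"
    using bij_betw_imp_surj_on[OF g] by (simp add: verts_H1 del: One_nat_def)
  ultimately have "spine_triangle G (g (Inr 0)) (g (Inr 1)) (g (Inr 2)) {g (Inl 0)} {}"
    by unfold_locales (auto simp: G)
  then show "\<exists>x y w l. spine_triangle G x y w {l} {}" by blast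
next
  assume "\<exists>x y w l. spine_triangle G x y w {l} {}"
  then obtain x y w l where "spine_triangle G x y w {l} {}" by blast
  then interpret spine_triangle G x y w "{l}" "{}" .
  let ?f = "\<lambda>v. if v = l then Inl 0 else if v = x then Inr 0 else if v = y then Inr 1 else Inr (2::nat)"
  show "isomorphic G H1"
  proof (rule isomorphic_if_nbhd[OF G])
    show "bij_betw ?f (verts G) (verts H1)"
      using distinct by (auto simp: bij_betw_def inj_on_def verts verts_H1 simp del: One_nat_def)
    show "nbhd H1 (?f v) = ?f ` nbhd G v" if "v \<in> verts G" for v
      using that distinct nbhd_x nbhd_y nbhd_w nbhd_A[of l]
      by (auto simp: verts nbhd_H1 simp del: One_nat_def)
  qed
qed

lemma nbhd_H2:
  "nbhd H2 (Inl 0) = {Inr 0}"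
  "nbhd H2 (Inr 0) = {Inr 1, Inr 3, Inl 0}"
  "nbhd H2 (Inr 1) = {Inr 0, Inr 2}"
  "nbhd H2 (Inr 2) = {Inr 1, Inr 3}"
  "nbhd H2 (Inr 3) = {Inr 0, Inr 2}"
  by (auto simp: nbhd_def H2_eq doubleton_eq_iff)

lemma verts_H2: "verts H2 = {Inl 0, Inr 0, Inr 1, Inr 2, Inr 3}"
  by (simp add: H2_eq)

lemma isomorphic_H2_iff:
  assumes G: "simple_graph G"
  shows "isomorphic G H2 \<longleftrightarrow> (\<exists>x y x' y' l. spine_square G x y x' y' {l} {})"
proof
  have H: "simple_graph H2" by (auto simp: simple_graph_def H2_eq)
  assume "isomorphic G H2"
  then obtain g where g: "bij_betw g (verts H2) (verts G)"
    and nb: "\<And>v. v \<in> verts H2 \<Longrightarrow> nbhd G (g v) = g ` nbhd H2 v"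
    using isomorphicE[OF G H] by blast
  have "nbhd G (g (Inl 0)) = {g (Inr 0)}"
    "nbhd G (g (Inr 0)) = {g (Inr 1), g (Inr 3), g (Inl 0)}"
    "nbhd G (g (Inr 1)) = {g (Inr 0), g (Inr 2)}"
    "nbhd G (g (Inr 2)) = {g (Inr 1), g (Inr 3)}"
    "nbhd G (g (Inr 3)) = {g (Inr 0), g (Inr 2)}"
    using nb[of "Inl 0"] nb[of "Inr 0"] nb[of "Inr 1"] nb[of "Inr 2"] nb[of "Inr 3"] by (simp_all add: verts_H2 nbhd_H2 del: One_nat_def)
  moreover have "distinct [g (Inl 0), g (Inr 0), g (Inr 1), g (Inr 2), g (Inr 3)]"
    using bij_betw_imp_inj_on[OF g] by (simp add: verts_H2 inj_on_def del: One_nat_def)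
  moreover have "verts G = {g (Inl 0), g (Inr 0), g (Inr 1), g (Inr 2), g (Inr 3)}"
    using bij_betw_imp_surj_on[OF g] by (simp add: verts_H2 del: One_nat_def)
  ultimately have "spine_square G (g (Inr 0)) (g (Inr 1)) (g (Inr 3)) (g (Inr 2)) {g (Inl 0)} {}"
    by unfold_locales (auto simp: G)
  then show "\<exists>x y x' y' l. spine_square G x y x' y' {l} {}" by blast
next
  assume "\<exists>x y x' y' l. spine_square G x y x' y' {l} {}"
  then obtain x y x' y' l where "spine_square G x y x' y' {l} {}" by blast
  then interpret spine_square G x y x' y' "{l}" "{}" .
  let ?f = "\<lambda>v. if v = l then Inl 0 else if v = x then Inr 0 else if v = y then Inr 1
    else if v = y' then Inr 2 else Inr (3::nat)"
  show "isomorphic G H2"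
  proof (rule isomorphic_if_nbhd[OF G])
    show "bij_betw ?f (verts G) (verts H2)"
      using distinct by (auto simp: bij_betw_def inj_on_def verts verts_H2 simp del: One_nat_def)
    show "nbhd H2 (?f v) = ?f ` nbhd G v" if "v \<in> verts G" for v
      using that distinct nbhd_x nbhd_y nbhd_x' nbhd_y' nbhd_A[of l]
      by (auto simp: verts nbhd_H2 simp del: One_nat_def)
  qed
qed

lemma nbhd_H3:
  "nbhd H3 0 = {1}"
  "nbhd H3 1 = {4, 2, 0}"
  "nbhd H3 2 = {1, 3}"
  "nbhd H3 3 = {4, 2}"
  "nbhd H3 4 = {1, 3, 5}"
  "nbhd H3 5 = {4}"
  by (auto simp: nbhd_def H3_eq doubleton_eq_iff)

lemma verts_H3: "verts H3 = {0, 1, 2, 3, 4, 5}"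
  by (simp add: H3_eq)

lemma isomorphic_H3_iff:
  assumes G: "simple_graph G"
  shows "isomorphic G H3 \<longleftrightarrow> (\<exists>x y x' y' l m. spine_square G x y x' y' {l} {m})"
proof
  have H: "simple_graph H3" by (auto simp: simple_graph_def H3_eq)
  assume "isomorphic G H3"
  then obtain g where g: "bij_betw g (verts H3) (verts G)"
    and nb: "\<And>v. v \<in> verts H3 \<Longrightarrow> nbhd G (g v) = g ` nbhd H3 v"
    using isomorphicE[OF G H] by blast
  have "nbhd G (g 0) = {g 1}"
    "nbhd G (g 1) = {g 4, g 2, g 0}"
    "nbhd G (g 2) = {g 1, g 3}"
    "nbhd G (g 3) = {g 4, g 2}"
    "nbhd G (g 4) = {g 1, g 3, g 5}"
    "nbhd G (g 5) = {g 4}"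
    using nb[of "0"] nb[of "1"] nb[of "2"] nb[of "3"] nb[of "4"] nb[of "5"] by (simp_all add: verts_H3 nbhd_H3 del: One_nat_def)
  moreover have "distinct [g 0, g 1, g 2, g 3, g 4, g 5]"
    using bij_betw_imp_inj_on[OF g] by (simp add: verts_H3 inj_on_def del: One_nat_def)
  moreover have "verts G = {g 0, g 1, g 2, g 3, g 4, g 5}"
    using bij_betw_imp_surj_on[OF g] by (simp add: verts_H3 del: One_nat_def)
  ultimately have "spine_square G (g 1) (g 4) (g 2) (g 3) {g 0} {g 5}"
    by unfold_locales (auto simp: G)
  then show "\<exists>x y x' y' l m. spine_square G x y x' y' {l} {m}" by blast
next
  assume "\<exists>x y x' y' l m. spine_square G x y x' y' {l} {m}"
  then obtain x y x' y' l m where "spine_square G x y x' y' {l} {m}" by blast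
  then interpret spine_square G x y x' y' "{l}" "{m}" .
  let ?f = "\<lambda>v. if v = l then 0 else if v = x then 1 else if v = x' then 2
    else if v = y' then 3 else if v = y then 4 else (5::nat)"
  show "isomorphic G H3"
  proof (rule isomorphic_if_nbhd[OF G])
    show "bij_betw ?f (verts G) (verts H3)"
      using distinct by (auto simp: bij_betw_def inj_on_def verts verts_H3 simp del: One_nat_def)
    show "nbhd H3 (?f v) = ?f ` nbhd G v" if "v \<in> verts G" for v
      using that distinct nbhd_x nbhd_y nbhd_x' nbhd_y' nbhd_A[of l] nbhd_B[of m]
      by (auto simp: verts nbhd_H3 simp del: One_nat_def)
  qed
qed

section \<open>A triangle on the dominating edge\<close>

context spine_triangle
begin

lemma finite_leaves: "finite A" "finite B"
  using finite_verts[OF simple] by (simp_all add: verts)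

lemma fresh: "x \<noteq> y" "x \<noteq> w" "y \<noteq> w" "x \<notin> A" "y \<notin> A" "w \<notin> A" "x \<notin> B" "y \<notin> B" "w \<notin> B"
  "l \<in> A \<Longrightarrow> l \<notin> B"
  using distinct by auto

lemma sum_verts: "sum h (verts G) = (h x + h y + h w + sum h A + sum h B :: real)"
  using finite_leaves fresh distinct(3) by (simp add: verts sum.union_disjoint)

lemma swap: "spine_triangle G y x w B A"
  using distinct by unfold_locales (auto simp: simple verts nbhd_x nbhd_y nbhd_w nbhd_A nbhd_B)

text \<open>
  Weight one half on all vertices but \<open>x\<close> and \<open>y\<close> resolves by adjacency. Conversely, in the
  complement \<open>w\<close> and a leaf at \<open>x\<close> are resolved by themselves and \<open>y\<close> only, so \<open>w\<close> with the weight
  of \<open>y\<close> added behaves like one more twin of these leaves; likewise at \<open>y\<close>, with the weight of \<open>x\<close>.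
  If \<open>A\<close> is no singleton, its leaves are bounded as twins and \<open>w\<close> is counted with \<open>B\<close>, and vice versa.
  If both are singletons (the bull), three pairs add up to twice the total weight.
\<close>

lemma Sd_f_leaves_on_both:
  assumes "A \<noteq> {}" "B \<noteq> {}"
  shows "Sd_f G (complement G) = dim_f (complement G)"
proof (rule Sd_f_eq_by_half_set[OF simple, of "insert w (A \<union> B)"])
  show "insert w (A \<union> B) \<subseteq> verts G" by (auto simp: verts)
next
  obtain l m where lm: "l \<in> A" "m \<in> B" using assms by blast
  fix u v assume "u \<in> verts G - insert w (A \<union> B)" and v: "v \<in> verts G" "u \<noteq> v"
  then consider "u = x" | "u = y" by (auto simp: verts)
  then show "\<exists>p q. p \<noteq> q \<and> {p, q} \<subseteq> insert w (A \<union> B) \<inter> adj_res_set G u v"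
  proof cases
    case 1
    consider "v = y" | "v = w" | "v \<in> A" | "v \<in> B" using v 1 by (auto simp: verts)
    then show ?thesis
    proof cases
      case 1
      with \<open>u = x\<close> show ?thesis using lm fresh
        by (intro twoI[of l m]) (auto simp: adj_res_set_def nbhd_x nbhd_y)
    next
      case 2
      with \<open>u = x\<close> show ?thesis using lm fresh
        by (intro twoI[of l w]) (auto simp: adj_res_set_def nbhd_x nbhd_w)
    next
      case 3
      with \<open>u = x\<close> show ?thesis using lm fresh
        by (intro twoI[of v w]) (auto simp: adj_res_set_def nbhd_x nbhd_A)
    next
      case 4
      with \<open>u = x\<close> show ?thesis using lm fresh
        by (intro twoI[of l v]) (auto simp: adj_res_set_def nbhd_x nbhd_B)
    qed
  next
    case 2
    consider "v = x" | "v = w" | "v \<in> A" | "v \<in> B" using v 2 by (auto simp: verts)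
    then show ?thesis
    proof cases
      case 1
      with \<open>u = y\<close> show ?thesis using lm fresh
        by (intro twoI[of l m]) (auto simp: adj_res_set_def nbhd_x nbhd_y)
    next
      case 2
      with \<open>u = y\<close> show ?thesis using lm fresh
        by (intro twoI[of m w]) (auto simp: adj_res_set_def nbhd_y nbhd_w)
    next
      case 3
      with \<open>u = y\<close> show ?thesis using lm fresh
        by (intro twoI[of m v]) (auto simp: adj_res_set_def nbhd_y nbhd_A)
    next
      case 4
      with \<open>u = y\<close> show ?thesis using lm fresh
        by (intro twoI[of v w]) (auto simp: adj_res_set_def nbhd_y nbhd_B)
    qed
  qed
next
  fix h assume h: "resolving_function (complement G) h"
  have pos: "0 \<le> h x" "0 \<le> h y" using resolving_function_nonneg[OF h] by (simp_all add: verts)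
  obtain l m where lm: "l \<in> A" "m \<in> B" using assms by blast
  have wl: "1 \<le> (h w + h y) + h l" if "l \<in> A" for l
  proof -
    have "1 \<le> sum_list (map h [w, y, l])"
      using that fresh lm
      by (intro complement_pair_list[OF simple h, of w l])
        (auto simp: verts adj_res_set_def nbhd_w nbhd_A nbhd_x)
    then show ?thesis by (simp add: add.assoc)
  qed
  have wm: "1 \<le> (h w + h x) + h m" if "m \<in> B" for m
  proof -
    have "1 \<le> sum_list (map h [w, x, m])"
      using that fresh lm
      by (intro complement_pair_list[OF simple h, of w m])
        (auto simp: verts adj_res_set_def nbhd_w nbhd_B nbhd_y)
    then show ?thesis by (simp add: add.assoc)
  qed
  have lm': "1 \<le> h l + h m + h x + h y" if "l \<in> A" "m \<in> B" for l m
  proof -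
    have "1 \<le> sum_list (map h [l, m, x, y])"
      using that fresh
      by (intro complement_pair_list[OF simple h, of l m])
        (auto simp: verts adj_res_set_def nbhd_A nbhd_B)
    then show ?thesis by (simp add: add.assoc)
  qed
  have twin_A: "1 \<le> h s + h t" if "s \<in> A" "t \<in> A" "s \<noteq> t" for s t
    using that fresh by (intro complement_twin_pair[OF simple h]) (auto simp: verts nbhd_A)
  have twin_B: "1 \<le> h s + h t" if "s \<in> B" "t \<in> B" "s \<noteq> t" for s t
    using that fresh by (intro complement_twin_pair[OF simple h]) (auto simp: verts nbhd_B)
  have A: "(card A + 1) / 2 \<le> (h w + h y) + sum h A"
    using finite_leaves assms twin_A wl by (intro half_card_le_sum_extra) auto
  have B: "(card B + 1) / 2 \<le> (h w + h x) + sum h B"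
    using finite_leaves assms twin_B wm by (intro half_card_le_sum_extra) auto
  have "card (insert w (A \<union> B)) = card A + card B + 1"
    using fresh finite_leaves distinct(3) by (simp add: card_Un_disjoint)
  moreover have "(card A + card B + 1) / 2 \<le> h x + h y + h w + sum h A + sum h B"
  proof -
    consider "card A \<noteq> 1" | "card B \<noteq> 1" | "card A = 1" "card B = 1" by blast
    then show ?thesis
    proof cases
      case 1
      then have "card A / 2 \<le> sum h A"
        using finite_leaves twin_A by (intro half_card_le_sum) auto
      then show ?thesis using B pos by (simp add: field_simps)
    next
      case 2
      then have "card B / 2 \<le> sum h B"
        using finite_leaves twin_B by (intro half_card_le_sum) auto
      then show ?thesis using A pos by (simp add: field_simps)
    next
      case 3
      then have "A = {l}" "B = {m}" using lm by (auto simp: card_1_singleton_iff)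
      then show ?thesis using wl[of l] wm[of m] lm'[of l m] by simp
    qed
  qed
  ultimately show "card (insert w (A \<union> B)) / 2 \<le> sum h (verts G)" by (simp add: sum_verts)
qed

text \<open>
  The leaf set may be a singleton here: the same function is optimal for \<open>H1\<close> itself.
\<close>

lemma half_leaves_on_x:
  assumes "B = {}" "A \<noteq> {}"
  shows "adj_resolving_function G (uniform_on 2 ({y, w} \<union> A))"
proof (rule half_on_adj_resolving[OF simple])
  obtain l where l: "l \<in> A" using assms(2) by blast
  fix u v assume "u \<in> verts G - ({y, w} \<union> A)" and v: "v \<in> verts G" "u \<noteq> v"
  then have u: "u = x" using assms(1) by (auto simp: verts)
  then consider "v \<in> {y, w}" | "v \<in> A" using v assms(1) by (auto simp: verts)
  then show "\<exists>p q. p \<noteq> q \<and> {p, q} \<subseteq> ({y, w} \<union> A) \<inter> adj_res_set G u v"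
  proof cases
    case 1
    then show ?thesis using u l fresh
      by (intro twoI[of v l]) (auto simp: adj_res_set_def nbhd_x nbhd_w nbhd_y assms(1))
  next
    case 2
    then show ?thesis using u fresh
      by (intro twoI[of y w]) (auto simp: adj_res_set_def nbhd_x nbhd_A)
  qed
qed

lemma Sd_f_leaves_on_x:
  assumes "B = {}" "card A \<noteq> 1"
  shows "Sd_f G (complement G) = dim_f (complement G)"
proof (cases "A = {}")
  case True
  have twins: "1 \<le> h u + h v"
    if h: "resolving_function (complement G) h" and "u \<in> verts G" "v \<in> verts G" "u \<noteq> v" for h u v
    using that(2-) fresh assms True
    by (intro complement_twin_pair[OF simple h]) (auto simp: verts nbhd_x nbhd_y nbhd_w)
  show ?thesis
  proof (rule Sd_f_eq_by_half_set[OF simple order_refl])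
    fix h assume h: "resolving_function (complement G) h"
    have "card (verts G) \<noteq> 1" using fresh assms True by (simp add: verts)
    then show "card (verts G) / 2 \<le> sum h (verts G)"
      using twins[OF h] finite_verts[OF simple] by (intro half_card_le_sum) auto
  qed simp
next
  case False
  show ?thesis
  proof (rule Sd_f_eq_dim_f_complement[OF simple half_leaves_on_x[OF assms(1) False]])
    have "card ({y, w} \<union> A) = card A + 2" using fresh finite_leaves by simp
    moreover have "{y, w} \<union> A \<subseteq> verts G" by (auto simp: verts)
    ultimately show "sum (uniform_on 2 ({y, w} \<union> A)) (verts G) = card A / 2 + 1"
      using finite_verts[OF simple] by (simp add: sum_uniform_on Int_absorb2 add_divide_distrib)
  next
    fix h assume h: "resolving_function (complement G) h"
    have "0 \<le> h x" using resolving_function_nonneg[OF h] by (simp add: verts)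
    moreover have "1 \<le> h y + h w"
      using fresh assms(1)
      by (intro complement_twin_pair[OF simple h]) (auto simp: verts nbhd_w nbhd_y)
    moreover have "card A / 2 \<le> sum h A"
      using finite_leaves(1) nbhd_A assms(2) verts
      by (intro half_card_le_sum_complement_twins[OF simple h]) auto
    ultimately show "card A / 2 + 1 \<le> sum h (verts G)"
      by (simp add: sum_verts assms(1))
  qed
qed

end

section \<open>A square on the dominating edge\<close>

context spine_square
begin

lemma finite_leaves: "finite A" "finite B"
  using finite_verts[OF simple] by (simp_all add: verts)

lemma fresh: "x \<noteq> y" "x \<noteq> x'" "x \<noteq> y'" "y \<noteq> x'" "y \<noteq> y'" "x' \<noteq> y'"
  "x \<notin> A" "y \<notin> A" "x' \<notin> A" "y' \<notin> A" "x \<notin> B" "y \<notin> B" "x' \<notin> B" "y' \<notin> B"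
  "l \<in> A \<Longrightarrow> l \<notin> B"
  using distinct by auto

lemma sum_verts: "sum h (verts G) = (h x + h y + h x' + h y' + sum h A + sum h B :: real)"
  using finite_leaves fresh distinct(3) by (simp add: verts sum.union_disjoint)

lemma swap: "spine_square G y x y' x' B A"
  using distinct by unfold_locales (auto simp: simple verts nbhd_x nbhd_y nbhd_x' nbhd_y' nbhd_A nbhd_B)

lemmas nbhds = nbhd_x nbhd_y nbhd_x' nbhd_y' nbhd_A nbhd_B

context
  fixes h
  assumes h: "resolving_function (complement G) h"
begin

lemma leaf_twins_A: "card A \<noteq> 1 \<Longrightarrow> card A / 2 \<le> sum h A"
  using finite_leaves(1) nbhd_A verts
  by (intro half_card_le_sum_complement_twins[OF simple h]) auto

lemma leaf_twins_B: "card B \<noteq> 1 \<Longrightarrow> card B / 2 \<le> sum h B"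
  using finite_leaves(2) nbhd_B verts
  by (intro half_card_le_sum_complement_twins[OF simple h]) auto

lemma pair_x_leaf: "A = {l} \<Longrightarrow> 1 \<le> h x + h l + h x' + h y"
  using complement_pair_list[OF simple h, of x l "[x, l, x', y]"] fresh
  by (auto simp: verts adj_res_set_def nbhds add.assoc)

text \<open>
  The centre \<open>y\<close> is a neighbour of both \<open>x\<close> and \<open>y'\<close>, but it can resolve them in the complement,
  where it is farther from \<open>x\<close> because \<open>xy\<close> is a dominating edge.
\<close>

lemma pair_x_y': "A = {l} \<Longrightarrow> B \<noteq> {} \<Longrightarrow> 1 \<le> h x + h y' + h l + h y"
  using complement_pair_list[OF simple h, of x y' "[x, y', l, y]"] fresh
  by (auto simp: verts adj_res_set_def nbhds add.assoc)

lemma pair_x'_leaf: "l \<in> A \<Longrightarrow> B \<noteq> {} \<Longrightarrow> 1 \<le> h x' + h l + h y'"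
  using complement_pair_list[OF simple h, of x' l "[x', l, y']"] fresh
  by (auto simp: verts adj_res_set_def nbhds add.assoc)

lemma pair_x'_y': "1 \<le> h x' + h y' + h x + h y"
  using complement_pair_list[OF simple h, of x' y' "[x', y', x, y]"] fresh
  by (auto simp: verts adj_res_set_def nbhds add.assoc)

lemma pair_leaves: "A = {l} \<Longrightarrow> B = {m} \<Longrightarrow> 1 \<le> h l + h m + h x + h y"
  using complement_pair_list[OF simple h, of l m "[l, m, x, y]"] fresh
  by (auto simp: verts adj_res_set_def nbhds add.assoc)

end

lemma Sd_f_no_leaves:
  assumes "A = {}" "B = {}"
  shows "Sd_f G (complement G) = dim_f (complement G)"
proof (rule Sd_f_eq_by_half_set[OF simple order_refl])
  fix h assume h: "resolving_function (complement G) h"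
  have "1 \<le> h x + h y'" "1 \<le> h y + h x'"
    using assms fresh by (auto intro!: complement_twin_pair[OF simple h] simp: verts nbhds)
  moreover have "card (verts G) = 4" using assms fresh by (simp add: verts)
  ultimately show "card (verts G) / 2 \<le> sum h (verts G)" by (simp add: sum_verts assms)
qed simp

lemma Sd_f_leaves_on_x:
  assumes "B = {}" "2 \<le> card A"
  shows "Sd_f G (complement G) = dim_f (complement G)"
proof (rule Sd_f_eq_by_half_set[OF simple, of "{y, x'} \<union> A"])
  show "{y, x'} \<union> A \<subseteq> verts G" by (auto simp: verts)
next
  obtain l where l: "l \<in> A" using assms(2) by fastforce
  obtain k where k: "k \<in> A" "k \<noteq> l" using two_elements[OF assms(2) l] by blast
  fix u v assume "u \<in> verts G - ({y, x'} \<union> A)" and v: "v \<in> verts G" "u \<noteq> v"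
  then consider "u = x" "v = y'" | "u = x" "v \<in> {y, x'}" | "u = x" "v \<in> A"
    | "u = y'" "v = x" | "u = y'" "v \<in> {y, x'}" | "u = y'" "v \<in> A"
    using assms(1) by (auto simp: verts)
  then show "\<exists>p q. p \<noteq> q \<and> {p, q} \<subseteq> ({y, x'} \<union> A) \<inter> adj_res_set G u v"
  proof cases
    case 1
    then show ?thesis using l k fresh by (intro twoI[of k l]) (auto simp: adj_res_set_def nbhds)
  next
    case 2
    then show ?thesis using l k fresh assms
      by (intro twoI[of k l]) (auto simp: adj_res_set_def nbhds)
  next
    case 3
    then show ?thesis using l k fresh by (intro twoI[of y x']) (auto simp: adj_res_set_def nbhds)
  next
    case 4
    then show ?thesis using l k fresh by (intro twoI[of k l]) (auto simp: adj_res_set_def nbhds)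
  next
    case 5
    then show ?thesis using fresh assms(1) by (intro twoI[of y x']) (auto simp: adj_res_set_def nbhds)
  next
    case 6
    then show ?thesis using fresh assms(1) by (intro twoI[of y x']) (auto simp: adj_res_set_def nbhds)
  qed
next
  fix h assume h: "resolving_function (complement G) h"
  have "0 \<le> h x" "0 \<le> h y'" using resolving_function_nonneg[OF h] by (simp_all add: verts)
  moreover have "1 \<le> h y + h x'"
    using assms fresh by (intro complement_twin_pair[OF simple h]) (auto simp: verts nbhds)
  moreover have "card A / 2 \<le> sum h A" using leaf_twins_A[OF h] assms(2) by simp
  moreover have "card ({y, x'} \<union> A) = card A + 2" using fresh finite_leaves by simp
  ultimately show "card ({y, x'} \<union> A) / 2 \<le> sum h (verts G)"
    by (simp add: sum_verts assms(1) add_divide_distrib)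
qed

text \<open>
  This function is shared by the graphs with several leaves at both centres and by \<open>H3\<close>.
\<close>

lemma half_leaves_on_both:
  assumes "A \<noteq> {}" "B \<noteq> {}"
  shows "adj_resolving_function G (uniform_on 2 ({x', y'} \<union> A \<union> B))"
proof (rule half_on_adj_resolving[OF simple])
  obtain l m where lm: "l \<in> A" "m \<in> B" using assms by blast
  have "l \<noteq> m" using lm fresh by auto
  fix u v assume "u \<in> verts G - ({x', y'} \<union> A \<union> B)" and v: "v \<in> verts G" "u \<noteq> v"
  then consider "{u, v} = {x, y}" | "u = x" "v \<in> {x', y'}" | "u = x" "v \<in> A" | "u = x" "v \<in> B"
    | "u = y" "v \<in> {x', y'}" | "u = y" "v \<in> A" | "u = y" "v \<in> B"
    by (auto simp: verts)
  then show "\<exists>p q. p \<noteq> q \<and> {p, q} \<subseteq> ({x', y'} \<union> A \<union> B) \<inter> adj_res_set G u v"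
  proof cases
    case 1
    then have "adj_res_set G u v = adj_res_set G x y"
      using adj_res_set_commute[of G x y] by (auto simp: doubleton_eq_iff)
    then show ?thesis using lm \<open>l \<noteq> m\<close> fresh by (intro twoI[of l m]) (auto simp: adj_res_set_def nbhds)
  next
    case 2
    then show ?thesis using lm fresh by (intro twoI[of v l]) (auto simp: adj_res_set_def nbhds)
  next
    case 3
    then show ?thesis using fresh by (intro twoI[of v x']) (auto simp: adj_res_set_def nbhds)
  next
    case 4
    then show ?thesis using lm fresh by (intro twoI[of v l]) (auto simp: adj_res_set_def nbhds)
  next
    case 5
    then show ?thesis using lm fresh by (intro twoI[of v m]) (auto simp: adj_res_set_def nbhds)
  next
    case 6
    then show ?thesis using lm fresh by (intro twoI[of v m]) (auto simp: adj_res_set_def nbhds)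
  next
    case 7
    then show ?thesis using fresh by (intro twoI[of v y']) (auto simp: adj_res_set_def nbhds)
  qed
qed

lemma sum_half_leaves_on_both:
  "sum (uniform_on 2 ({x', y'} \<union> A \<union> B)) (verts G) = card A / 2 + card B / 2 + 1"
proof -
  have "card ({x', y'} \<union> A \<union> B) = card A + card B + 2"
    using fresh finite_leaves distinct(3) by (simp add: card_Un_disjoint)
  moreover have "{x', y'} \<union> A \<union> B \<subseteq> verts G" by (auto simp: verts)
  ultimately show ?thesis
    using finite_verts[OF simple] by (simp add: sum_uniform_on Int_absorb2 add_divide_distrib)
qed

text \<open>
  Besides the leaves, which are twins, the pair \<open>x'\<close>, \<open>y'\<close> needs weight one on the cycle.
\<close>

lemma Sd_f_many_leaves_on_both:
  assumes "2 \<le> card A" "2 \<le> card B"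
  shows "Sd_f G (complement G) = dim_f (complement G)"
proof (rule Sd_f_eq_dim_f_complement[OF simple half_leaves_on_both sum_half_leaves_on_both])
  show "A \<noteq> {}" "B \<noteq> {}" using assms by auto
next
  fix h assume h: "resolving_function (complement G) h"
  show "card A / 2 + card B / 2 + 1 \<le> sum h (verts G)"
    using pair_x'_y'[OF h] leaf_twins_A[OF h] leaf_twins_B[OF h] assms by (simp add: sum_verts)
qed

text \<open>
  With one leaf \<open>l\<close> at \<open>x\<close> there are no twins in \<open>A\<close> to force weight one half, and it is cheaper to
  spread weight \<open>4/3\<close> evenly over \<open>x\<close>, \<open>x'\<close>, \<open>y'\<close> and \<open>l\<close>. This is optimal, since the constraints of
  the four pairs used at the end add up to three times the weight of \<open>x\<close>, \<open>y\<close>, \<open>x'\<close>, \<open>y'\<close>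
  and \<open>l\<close>. The function still resolves \<open>y\<close> and \<open>x'\<close> by adjacency because \<open>B\<close> has two elements;
  if \<open>y\<close> has a single leaf too, the analogous function fails at this pair, and the graph is \<open>H3\<close>.
\<close>

lemma Sd_f_single_leaf_on_x:
  assumes A: "A = {l}" and B: "2 \<le> card B"
  shows "Sd_f G (complement G) = dim_f (complement G)"
proof -
  define g :: "'a \<Rightarrow> real" where "g = (\<lambda>v. if v \<in> B then 1 / 2 else if v = y then 0 else 1 / 3)"
  have "l \<notin> {x, y, x', y'} \<union> B" using fresh A by auto
  then have g: "g x = 1 / 3" "g y = 0" "g x' = 1 / 3" "g y' = 1 / 3" "g l = 1 / 3"
    and gB: "\<And>m. m \<in> B \<Longrightarrow> g m = 1 / 2"
    and l: "l \<noteq> x" "l \<noteq> y" "l \<noteq> x'" "l \<noteq> y'" "l \<notin> B"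
    using fresh by (auto simp: g_def)
  obtain m where m: "m \<in> B" using B by fastforce
  obtain k where k: "k \<in> B" "k \<noteq> m" using two_elements[OF B m] by blast
  \<comment> \<open>Each pair below comes with a list of resolving vertices of weight at least one.\<close>
  have three: "1 \<le> sum g (adj_res_set G u v)"
    if "set ds \<subseteq> adj_res_set G u v" "distinct ds" "1 \<le> sum_list (map g ds)" for ds u v
    using sum_list_le_sum[OF finite_adj_res_set[OF simple] that(1,2), of g] that(3) by (force simp: g_def)
  have xv: "1 \<le> sum g (adj_res_set G x v)" if v: "v \<in> verts G" "v \<noteq> x" for v
  proof -
    consider "v = y" | "v = x'" | "v = y'" | "v = l \<or> v \<in> B" using v A by (auto simp: verts)
    then show ?thesis
    proof cases
      case 1
      then show ?thesis
        using m k fresh A by (intro three[of "[m, k]"]) (auto simp: adj_res_set_def nbhds gB)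
    next
      case 2
      then show ?thesis
        using fresh l A by (intro three[of "[x, x', l]"]) (auto simp: adj_res_set_def nbhds g)
    next
      case 3
      then show ?thesis
        using fresh l A by (intro three[of "[x, y', l]"]) (auto simp: adj_res_set_def nbhds g)
    next
      case 4
      then show ?thesis
        using fresh l A by (intro three[of "[x, l, x']"]) (auto simp: adj_res_set_def nbhds g)
    qed
  qed
  have yv: "1 \<le> sum g (adj_res_set G y v)" if v: "v \<in> verts G" "v \<noteq> y" "v \<noteq> x" for v
  proof -
    consider "v \<in> {x', y', l}" | "v \<in> B" using v A by (auto simp: verts)
    then show ?thesis
    proof cases
      case 1
      then show ?thesis
        using m k fresh A l by (intro three[of "[m, k]"]) (auto simp: adj_res_set_def nbhds gB)
    next
      case 2
      then show ?thesis
        using fresh A by (intro three[of "[v, x, y']"]) (auto simp: adj_res_set_def nbhds g gB)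
    qed
  qed
  have x'v: "1 \<le> sum g (adj_res_set G x' v)" if "v = y' \<or> v = l \<or> v \<in> B" for v
    using that
  proof (elim disjE)
    assume "v = y'"
    then show ?thesis
      using fresh by (intro three[of "[x', y', x]"]) (auto simp: adj_res_set_def nbhds g)
  next
    assume "v = l"
    then show ?thesis
      using fresh l A by (intro three[of "[x', l, y']"]) (auto simp: adj_res_set_def nbhds g)
  next
    assume "v \<in> B"
    then show ?thesis
      using fresh by (intro three[of "[x', x, y']"]) (auto simp: adj_res_set_def nbhds g)
  qed
  have y'v: "1 \<le> sum g (adj_res_set G y' v)" if "v = l \<or> v \<in> B" for v
    using that fresh l A by (intro three[of "[y', v, x']"]) (auto simp: adj_res_set_def nbhds g gB)
  have lv: "1 \<le> sum g (adj_res_set G l v)" if "v \<in> B" for v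
    using that fresh l A by (intro three[of "[l, v, x]"]) (auto simp: adj_res_set_def nbhds g gB)
  have mv: "1 \<le> sum g (adj_res_set G u v)" if "u \<in> B" "v \<in> B" "u \<noteq> v" for u v
    using that by (intro three[of "[u, v]"]) (auto simp: adj_res_set_def gB)
  have "adj_resolving_function G g"
    unfolding adj_resolving_function_def
  proof (intro conjI ballI impI)
    fix u v assume uv: "u \<in> verts G" "v \<in> verts G" "u \<noteq> v"
    have V: "z = x \<or> z = y \<or> z = x' \<or> z = y' \<or> z = l \<or> z \<in> B" if "z \<in> verts G" for z
      using that A by (auto simp: verts)
    show "1 \<le> sum g (adj_res_set G u v)"
      using V[OF uv(1)] V[OF uv(2)] uv xv yv x'v y'v lv mv adj_res_set_commute[of G u v] by metis
  qed (auto simp: g_def)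
  then show ?thesis
  proof (rule Sd_f_eq_dim_f_complement[OF simple])
    have "sum g B = card B / 2" by (simp add: gB)
    then show "sum g (verts G) = card B / 2 + 4 / 3" by (simp add: sum_verts A g)
  next
    fix h assume h: "resolving_function (complement G) h"
    have "B \<noteq> {}" using m by blast
    then show "card B / 2 + 4 / 3 \<le> sum h (verts G)"
      using leaf_twins_B[OF h] B pair_x_leaf[OF h A] pair_x_y'[OF h A] pair_x'_leaf[OF h, of l]
        pair_x'_y'[OF h] A by (simp add: sum_verts)
  qed
qed

end

section \<open>A triangle beside the dominating edge\<close>

context side_triangle
begin

lemma finite_leaves: "finite A" "finite B"
  using finite_verts[OF simple] by (simp_all add: verts)

lemma fresh: "x \<noteq> y" "x \<noteq> v" "x \<noteq> w" "y \<noteq> v" "y \<noteq> w" "v \<noteq> w"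
  "x \<notin> A" "y \<notin> A" "v \<notin> A" "w \<notin> A" "x \<notin> B" "y \<notin> B" "v \<notin> B" "w \<notin> B"
  "l \<in> A \<Longrightarrow> l \<notin> B"
  using distinct by auto

lemma sum_verts: "sum h (verts G) = (h x + h y + h v + h w + sum h A + sum h B :: real)"
  using finite_leaves fresh distinct(3) by (simp add: verts sum.union_disjoint)

lemmas nbhds = nbhd_x nbhd_y nbhd_v nbhd_w nbhd_A nbhd_B

text \<open>
  Without leaves of its own, \<open>y\<close> is itself a leaf at \<open>x\<close>, and \<open>xv\<close> is a dominating edge of the
  triangle.
\<close>

lemma spine_triangle_if_no_leaf_on_y: "B = {} \<Longrightarrow> spine_triangle G x v w (insert y A) {}"
  using distinct by unfold_locales (auto simp: simple verts nbhds)

text \<open>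
  The weight one half on \<open>v\<close>, \<open>w\<close> and \<open>B\<close> leaves it open whether \<open>y\<close> and the leaves at \<open>x\<close> carry
  weight: \<open>x\<close> is told from \<open>v\<close> by any one of them, and \<open>y\<close> from its leaves either by two leaves or by
  \<open>y\<close> itself. Several leaves at \<open>x\<close> need weight as twins, a single one does not if \<open>y\<close> has weight.
\<close>

lemma half_set_resolving:
  assumes Y: "Y \<subseteq> {y}" and L: "L = A \<or> (\<exists>l. A = {l}) \<and> L = {} \<and> Y = {y}"
    and near_x: "Y \<union> L \<noteq> {}" and near_y: "2 \<le> card (Y \<union> B)" "B \<noteq> {}"
  shows "adj_resolving_function G (uniform_on 2 ({v, w} \<union> Y \<union> L \<union> B))"
proof (rule half_on_adj_resolving[OF simple])
  let ?H = "{v, w} \<union> Y \<union> L \<union> B"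
  obtain a where a: "a \<in> Y \<union> L" using near_x by blast
  then have a': "a = y \<or> a \<in> A" using Y L by blast
  obtain m where m: "m \<in> B" using near_y(2) by blast
  obtain k where k: "k \<in> Y \<union> B" "k \<noteq> m" using two_elements[OF near_y(1), of m] m by blast
  then have k': "k = y \<or> k \<in> B" using Y by blast
  fix u z assume u: "u \<in> verts G - ?H" and z: "z \<in> verts G" "u \<noteq> z"
  consider "u = x" "z \<notin> {v, w}" | "u = x" "z \<in> {v, w}" | "u = y" "z = x" | "u = y" "z \<in> {v, w}"
    | "u = y" "z \<in> A \<union> B" "u \<notin> Y" | "u \<in> A" "z \<in> {x, v, w}" | "u \<in> A" "u \<notin> L" "z = y"
    | "u \<in> A" "u \<notin> L" "z \<in> A" | "u \<in> A" "u \<notin> L" "z \<in> B"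
    using u z by (auto simp: verts)
  then show "\<exists>p q. p \<noteq> q \<and> {p, q} \<subseteq> ?H \<inter> adj_res_set G u z"
  proof cases
    case 1
    then have "z = y \<or> z \<in> A \<or> z \<in> B" using z by (auto simp: verts)
    then show ?thesis using 1 fresh by (intro twoI[of v w]) (auto simp: adj_res_set_def nbhds)
  next
    case 2
    have "a \<noteq> z" using a' 2 fresh by auto
    then show ?thesis using 2 a a' fresh by (intro twoI[of z a]) (auto simp: adj_res_set_def nbhds)
  next
    case 3
    then show ?thesis using fresh by (intro twoI[of v w]) (auto simp: adj_res_set_def nbhds)
  next
    case 4
    then show ?thesis using fresh by (intro twoI[of v w]) (auto simp: adj_res_set_def nbhds)
  next
    case 5
    then have "k \<in> B" using k Y by blast
    then show ?thesis using 5 k(2) m fresh by (intro twoI[of k m]) (auto simp: adj_res_set_def nbhds)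
  next
    case 6
    then show ?thesis using fresh by (intro twoI[of v w]) (auto simp: adj_res_set_def nbhds)
  next
    case 7
    then show ?thesis using L m fresh by (intro twoI[of y m]) (auto simp: adj_res_set_def nbhds)
  next
    case 8
    then show ?thesis using L z by blast
  next
    case 9
    then show ?thesis using L fresh by (intro twoI[of y z]) (auto simp: adj_res_set_def nbhds)
  qed
qed

lemma sum_half_set:
  assumes "Y \<subseteq> {y}" "L \<subseteq> A"
  shows "sum (uniform_on 2 ({v, w} \<union> Y \<union> L \<union> B)) (verts G) =
    1 + card Y / 2 + card L / 2 + card B / 2"
proof -
  have fin: "finite Y" "finite L" using assms finite_leaves finite_subset by auto
  have "{v, w} \<inter> Y = {}" "({v, w} \<union> Y) \<inter> L = {}" "({v, w} \<union> Y \<union> L) \<inter> B = {}"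
    using assms fresh distinct(3) by blast+
  then have "card ({v, w} \<union> Y \<union> L \<union> B) = 2 + card Y + card L + card B"
    using fin finite_leaves fresh(6) by (simp add: card_Un_disjoint del: Un_insert_left)
  moreover have "{v, w} \<union> Y \<union> L \<union> B \<subseteq> verts G" using assms by (auto simp: verts)
  ultimately show ?thesis
    using finite_verts[OF simple] by (simp add: sum_uniform_on Int_absorb2 add_divide_distrib)
qed

text \<open>
  The twins \<open>v\<close>, \<open>w\<close> take weight one, and leaves at the same centre are bounded as twins if there are
  several. A single leaf at \<open>y\<close> shares weight one with \<open>x\<close> and \<open>y\<close>, by the pair that it forms with \<open>y\<close>.
  A single leaf at \<open>x\<close>, with the weights of \<open>x\<close> and \<open>y\<close> added, acts as one more twin of several leaves
  at \<open>y\<close>. If \<open>x\<close> has no leaf, telling \<open>x\<close> from \<open>v\<close> and from \<open>w\<close> takes another half on \<open>v\<close>, \<open>w\<close>,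
  \<open>x\<close> and \<open>y\<close> together.
\<close>

lemma Sd_f_leaf_on_y:
  assumes "B \<noteq> {}"
  shows "Sd_f G (complement G) = dim_f (complement G)"
proof -
  have pos: "0 \<le> h x" "0 \<le> h y" "0 \<le> sum h A" "0 \<le> sum h B"
    if h: "resolving_function (complement G) h" for h
    using resolving_function_nonneg[OF h] by (auto simp: verts intro!: sum_nonneg)
  have vw: "1 \<le> h v + h w" if h: "resolving_function (complement G) h" for h
    using fresh by (intro complement_twin_pair[OF simple h]) (auto simp: verts nbhds)
  have A: "card A / 2 \<le> sum h A" if h: "resolving_function (complement G) h" and "card A \<noteq> 1" for h
    using finite_leaves nbhd_A verts that(2)
    by (intro half_card_le_sum_complement_twins[OF simple h]) auto
  have twins_B: "1 \<le> h s + h t"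
    if h: "resolving_function (complement G) h" and "s \<in> B" "t \<in> B" "s \<noteq> t" for h s t
    using that(2-) fresh by (intro complement_twin_pair[OF simple h]) (auto simp: verts nbhds)
  have B: "card B / 2 \<le> sum h B" if h: "resolving_function (complement G) h" and "2 \<le> card B" for h
    using finite_leaves that(2) twins_B[OF h] by (intro half_card_le_sum) auto
  have yB: "1 \<le> h x + h y + sum h B" if h: "resolving_function (complement G) h" for h
  proof -
    obtain m where m: "m \<in> B" using assms by blast
    have "1 \<le> sum h ({x, y} \<union> B)"
      using m fresh by (intro complement_pair[OF simple h, of y m]) (auto simp: verts adj_res_set_def nbhds)
    then show ?thesis using fresh finite_leaves by (simp add: add.assoc)
  qed
  have xv: "1 \<le> h x + h v + h y" and xw: "1 \<le> h x + h w + h y"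
    if h: "resolving_function (complement G) h" and "A = {}" for h
    using complement_pair_list[OF simple h, of x v "[x, v, y]"]
      complement_pair_list[OF simple h, of x w "[x, w, y]"] fresh that(2) assms
    by (auto simp: verts adj_res_set_def nbhds add.assoc)
  have lm: "1 \<le> h l + h m + h x + h y"
    if h: "resolving_function (complement G) h" and "l \<in> A" "m \<in> B" for h l m
  proof -
    have "l \<noteq> m" using that fresh by auto
    then show ?thesis
      using complement_pair_list[OF simple h, of l m "[l, m, x, y]"] fresh that(2,3)
      by (auto simp: verts adj_res_set_def nbhds add.assoc)
  qed
  have B0: "card B \<noteq> 0" using assms finite_leaves by simp
  have insert_y: "card ({y} \<union> B) = card B + 1" using fresh finite_leaves by simp
  have B12: "card B = 1 \<or> 2 \<le> card B" using B0 by linarith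
  have A1: "\<exists>l. A = {l}" if "card A = 1" using that by (simp add: card_1_singleton_iff)
  consider "2 \<le> card B" "A \<noteq> {}" | "2 \<le> card B" "A = {}" | "card B = 1" "card A \<noteq> 1"
    | l where "card B = 1" "A = {l}"
    using B12 A1 by blast
  then show ?thesis
  proof cases
    case 1
    show ?thesis
    proof (rule Sd_f_eq_dim_f_complement[OF simple half_set_resolving sum_half_set])
      fix h assume h: "resolving_function (complement G) h"
      have "card A / 2 + card B / 2 \<le> h x + h y + sum h A + sum h B"
      proof (cases "card A = 1")
        case True
        then obtain l where l: "A = {l}" by (auto simp: card_1_singleton_iff)
        have "(card B + 1) / 2 \<le> (h l + h x + h y) + sum h B"
          using finite_leaves assms twins_B[OF h] lm[OF h, of l] l
          by (intro half_card_le_sum_extra) (auto simp: add_ac)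
        then show ?thesis by (simp add: l add_divide_distrib)
      next
        case False
        then show ?thesis using A[OF h] B[OF h] 1 pos[OF h] by simp
      qed
      then show "1 + card ({} :: 'a set) / 2 + card A / 2 + card B / 2 \<le> sum h (verts G)"
        using vw[OF h] by (simp add: sum_verts)
    qed (use 1 in auto)
  next
    case 2
    show ?thesis
    proof (rule Sd_f_eq_dim_f_complement[OF simple half_set_resolving sum_half_set])
      fix h assume h: "resolving_function (complement G) h"
      show "1 + card {y} / 2 + card A / 2 + card B / 2 \<le> sum h (verts G)"
        using vw[OF h] xv[OF h] xw[OF h] B[OF h] 2 by (simp add: sum_verts)
    qed (use 2 insert_y in auto)
  next
    case 3
    show ?thesis
    proof (rule Sd_f_eq_dim_f_complement[OF simple half_set_resolving sum_half_set])
      fix h assume h: "resolving_function (complement G) h"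
      show "1 + card {y} / 2 + card A / 2 + card B / 2 \<le> sum h (verts G)"
        using vw[OF h] yB[OF h] A[OF h] 3 by (simp add: sum_verts)
    qed (use 3 insert_y assms in auto)
  next
    case 4
    show ?thesis
    proof (rule Sd_f_eq_dim_f_complement[OF simple half_set_resolving sum_half_set])
      fix h assume h: "resolving_function (complement G) h"
      show "1 + card {y} / 2 + card ({} :: 'a set) / 2 + card B / 2 \<le> sum h (verts G)"
        using vw[OF h] yB[OF h] pos[OF h] 4 by (simp add: sum_verts)
    qed (use 4 insert_y assms in auto)
  qed
qed

end

section \<open>The values for the exceptional graphs\<close>

lemma common_neighbour_not_resolving:
  assumes "simple_graph G" "z \<in> nbhd G u" "z \<in> nbhd G v"
  shows "z \<notin> resolving_set G u v"
  using assms by (simp add: resolving_set_def graph_dist_adjacent)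

lemma distance_two_not_resolving:
  assumes "simple_graph G" "z \<notin> insert u (nbhd G u)" "z \<notin> insert v (nbhd G v)"
    and "nbhd G u \<inter> nbhd G z \<noteq> {}" "nbhd G v \<inter> nbhd G z \<noteq> {}"
  shows "z \<notin> resolving_set G u v"
proof -
  obtain c d where "c \<in> nbhd G u" "c \<in> nbhd G z" "d \<in> nbhd G v" "d \<in> nbhd G z"
    using assms(4,5) by blast
  then show ?thesis
    using assms(2,3) graph_dist_two[OF assms(1), of u z c] graph_dist_two[OF assms(1), of v z d]
    by (auto simp: resolving_set_def)
qed

text \<open>
  In \<open>H1\<close> the twins \<open>y\<close>, \<open>w\<close> need weight one, and the complement, a path \<open>ylw\<close> plus the isolated
  vertex \<open>x\<close>, needs no more: being isolated, \<open>x\<close> is told from \<open>y\<close> by \<open>w\<close> and from \<open>w\<close> by \<open>y\<close>. In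
  \<open>H1\<close> the centre \<open>x\<close> is at distance one from both, so \<open>w\<close> does not tell it from \<open>y\<close>, nor \<open>y\<close>
  from \<open>w\<close>, and the minimum rises by one half.
\<close>

lemma (in spine_triangle) single_leaf_values:
  assumes A: "A = {l}" and B: "B = {}"
  shows "Sd_f G (complement G) = 3 / 2" "dim_f G = 3 / 2" "dim_f (complement G) = 1"
proof -
  have V: "verts G = {x, y, w, l}" using A B by (auto simp: verts)
  have l: "l \<noteq> x" "l \<noteq> y" "l \<noteq> w" using fresh A by auto
  have nb: "nbhd G x = {y, w, l}" "nbhd G l = {x}" "nbhd G y = {x, w}"
    using A B by (auto simp: nbhd_x nbhd_A nbhd_y)
  note nb = nb nbhd_w
  have sum_G: "sum h (verts G) = (h x + h y + h w + h l :: real)" for h by (simp add: sum_verts A B)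
  have G: "adj_resolving_function G (uniform_on 2 ({y, w} \<union> A))"
    using half_leaves_on_x A B by simp
  have sum: "sum (uniform_on 2 ({y, w} \<union> A)) (verts G) = 3 / 2"
    using fresh l by (simp add: sum_G uniform_on_def A)
  have low: "3 / 2 \<le> sum h (verts G)" if h: "resolving_function G h" for h
  proof -
    have "1 \<le> h y + h w"
      using fresh l by (intro twin_pair[OF simple h]) (auto simp: V nb)
    moreover have "1 \<le> sum h {x, y, l}"
      using common_neighbour_not_resolving[OF simple, of w x y] resolving_set_subset_verts[of G x y] fresh
      by (intro resolving_function_pair[OF simple h, of x y]) (auto simp: V nb)
    moreover have "1 \<le> sum h {x, w, l}"
      using common_neighbour_not_resolving[OF simple, of y x w] resolving_set_subset_verts[of G x w] fresh
      by (intro resolving_function_pair[OF simple h, of x w]) (auto simp: V nb)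
    ultimately show ?thesis using fresh l by (simp add: sum_G)
  qed
  show "Sd_f G (complement G) = 3 / 2" "dim_f G = 3 / 2"
    using Sd_f_eq_dim_f[OF simple G sum low] by simp_all
  have extra: "w \<in> resolving_set (complement G) x y" "y \<in> resolving_set (complement G) x w"
    using fresh l by (intro resolving_set_complement_dominating[OF simple];
      auto simp: dominating_edge_def V nb)+
  show "dim_f (complement G) = 1"
  proof (rule dim_f_eqI)
    show "resolving_function (complement G) (uniform_on 2 {y, w})"
    proof (rule half_on_resolving[OF simple_graph_complement[OF simple]])
      fix u v assume uv: "u \<in> verts (complement G) - {y, w}" "v \<in> verts (complement G)" "u \<noteq> v"
      then have sub: "adj_res_set G u v \<subseteq> resolving_set (complement G) u v"
        by (intro adj_res_set_subset_complement[OF simple]) auto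
      have "{y, w} \<subseteq> resolving_set (complement G) u v"
      proof -
        consider "u = x" "v = y" | "u = x" "v = w" | "u = x" "v = l"
          | "u = l" "v = x" | "u = l" "v \<in> {y, w}"
          using uv by (auto simp: V)
        then show ?thesis
          using sub extra fresh l by cases (auto simp: adj_res_set_def nb)
      qed
      then show "\<exists>p q. p \<noteq> q \<and> {p, q} \<subseteq> {y, w} \<inter> resolving_set (complement G) u v"
        using fresh by blast
    qed
    show "sum (uniform_on 2 {y, w}) (verts (complement G)) = 1"
      using fresh l by (simp add: sum_G uniform_on_def)
  next
    fix h assume h: "resolving_function (complement G) h"
    have "1 \<le> h y + h w"
      using fresh l by (intro complement_twin_pair[OF simple h]) (auto simp: V nb)
    moreover have "0 \<le> h x" "0 \<le> h l" using resolving_function_nonneg[OF h] by (simp_all add: V)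
    ultimately show "1 \<le> sum h (verts (complement G))" by (simp add: sum_G)
  qed
qed

text \<open>
  In \<open>H2\<close> the pair \<open>x\<close>, \<open>y'\<close> of opposite vertices is resolved only by \<open>x\<close>, \<open>y'\<close> and \<open>l\<close>, which is
  disjoint from the twins \<open>y\<close>, \<open>x'\<close>. In the complement the twins resolve this pair too, since \<open>xy\<close>
  and \<open>xx'\<close> are dominating edges.
\<close>

lemma (in spine_square) single_leaf_values:
  assumes A: "A = {l}" and B: "B = {}"
  shows "Sd_f G (complement G) = 2" "dim_f G = 2" "dim_f (complement G) = 3 / 2"
proof -
  have V: "verts G = {x, y, x', y', l}" using A B by (auto simp: verts)
  have l: "l \<noteq> x" "l \<noteq> y" "l \<noteq> x'" "l \<noteq> y'" using fresh A by auto
  have nb: "nbhd G x = {y, x', l}" "nbhd G l = {x}" "nbhd G y = {x, y'}"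
    using A B by (auto simp: nbhds)
  note nb = nb nbhd_x' nbhd_y'
  have sum_G: "sum h (verts G) = (h x + h y + h x' + h y' + h l :: real)" for h
    by (simp add: sum_verts A B)
  have G: "adj_resolving_function G (uniform_on 2 {y, x', y', l})"
  proof (rule half_on_adj_resolving[OF simple])
    fix u v assume "u \<in> verts G - {y, x', y', l}" and v: "v \<in> verts G" "u \<noteq> v"
    then consider "u = x" "v \<in> {y, x', y'}" | "u = x" "v = l" by (auto simp: V)
    then show "\<exists>p q. p \<noteq> q \<and> {p, q} \<subseteq> {y, x', y', l} \<inter> adj_res_set G u v"
    proof cases
      case 1
      then show ?thesis using fresh l by (intro twoI[of v l]) (auto simp: adj_res_set_def nb)
    next
      case 2
      then show ?thesis using fresh l by (intro twoI[of y l]) (auto simp: adj_res_set_def nb)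
    qed
  qed
  have sum: "sum (uniform_on 2 {y, x', y', l}) (verts G) = 2"
    using fresh l by (simp add: sum_G uniform_on_def)
  have low: "2 \<le> sum h (verts G)" if h: "resolving_function G h" for h
  proof -
    have "1 \<le> h y + h x'"
      using fresh l by (intro twin_pair[OF simple h]) (auto simp: V nb)
    moreover have "1 \<le> sum h {x, y', l}"
      using common_neighbour_not_resolving[OF simple, of y x y']
        common_neighbour_not_resolving[OF simple, of x' x y'] resolving_set_subset_verts[of G x y'] fresh
      by (intro resolving_function_pair[OF simple h, of x y']) (auto simp: V nb)
    ultimately show ?thesis using fresh l by (simp add: sum_G)
  qed
  show "Sd_f G (complement G) = 2" "dim_f G = 2"
    using Sd_f_eq_dim_f[OF simple G sum low] by simp_all
  have extra: "y \<in> resolving_set (complement G) x y'" "x \<in> resolving_set (complement G) l y"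
    "x \<in> resolving_set (complement G) l x'"
    using fresh l by (intro resolving_set_complement_dominating[OF simple];
      auto simp: dominating_edge_def V nb)+
  show "dim_f (complement G) = 3 / 2"
  proof (rule dim_f_eqI)
    show "resolving_function (complement G) (uniform_on 2 {y, x', x})"
    proof (rule half_on_resolving[OF simple_graph_complement[OF simple]])
      fix u v assume uv: "u \<in> verts (complement G) - {y, x', x}" "v \<in> verts (complement G)" "u \<noteq> v"
      then have sub: "adj_res_set G u v \<subseteq> resolving_set (complement G) u v"
        by (intro adj_res_set_subset_complement[OF simple]) auto
      consider "u = y'" "v = x" | "u = y'" "v \<in> {y, x', l}" | "u = l" "v = x"
        | "u = l" "v = y'" | "u = l" "v \<in> {y, x'}"
        using uv by (auto simp: V)
      then show "\<exists>p q. p \<noteq> q \<and> {p, q} \<subseteq> {y, x', x} \<inter> resolving_set (complement G) u v"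
      proof cases
        case 1
        then show ?thesis using sub extra(1) fresh resolving_set_commute[of "complement G" x y']
          by (intro twoI[of x y]) (auto simp: adj_res_set_def)
      next
        case 2
        then show ?thesis using sub fresh l by (intro twoI[of y x']) (auto simp: adj_res_set_def nb)
      next
        case 3
        then show ?thesis using sub fresh l by (intro twoI[of y x']) (auto simp: adj_res_set_def nb)
      next
        case 4
        then show ?thesis using sub fresh l by (intro twoI[of y x']) (auto simp: adj_res_set_def nb)
      next
        case 5
        then show ?thesis using sub extra(2,3) fresh
          by (intro twoI[of v x]) (auto simp: adj_res_set_def)
      qed
    qed
    show "sum (uniform_on 2 {y, x', x}) (verts (complement G)) = 3 / 2"
      using fresh l by (simp add: sum_G uniform_on_def)
  next
    fix h assume h: "resolving_function (complement G) h"
    have "1 \<le> h y + h x'"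
      using fresh l by (intro complement_twin_pair[OF simple h]) (auto simp: V nb)
    moreover have "1 \<le> sum_list (map h [l, y, x, y'])"
      using fresh l by (intro complement_pair_list[OF simple h, of l y]) (auto simp: V adj_res_set_def nb)
    moreover have "1 \<le> sum_list (map h [l, x', x, y'])"
      using fresh l by (intro complement_pair_list[OF simple h, of l x']) (auto simp: V adj_res_set_def nb)
    ultimately show "3 / 2 \<le> sum h (verts (complement G))" by (simp add: sum_G)
  qed
qed

text \<open>
  In \<open>H3\<close> the two diagonals of the square have disjoint resolving sets, which forces weight two. In the
  complement each diagonal is also resolved across the dominating edge \<open>xy\<close>, and weight one third on
  all vertices but \<open>y\<close> suffices. The matching lower bound combines seven pairs: the four that join a
  centre to its leaf or to its opposite vertex with coefficient \<open>1/6\<close>, the other three with coefficient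
  \<open>1/3\<close>.
\<close>

lemma (in spine_square) single_leaf_on_both_values:
  assumes A: "A = {l}" and B: "B = {m}"
  shows "Sd_f G (complement G) = 2" "dim_f G = 2" "dim_f (complement G) = 5 / 3"
proof -
  interpret swapped: spine_square G y x y' x' B A by (rule swap)
  have V: "verts G = {x, y, x', y', l, m}" using A B by (auto simp: verts)
  have l: "l \<noteq> x" "l \<noteq> y" "l \<noteq> x'" "l \<noteq> y'" "m \<noteq> x" "m \<noteq> y" "m \<noteq> x'" "m \<noteq> y'" "l \<noteq> m"
    using fresh A B by auto
  have nb: "nbhd G x = {y, x', l}" "nbhd G l = {x}" "nbhd G y = {x, y', m}" "nbhd G m = {y}"
    using A B by (auto simp: nbhds)
  note nb = nb nbhd_x' nbhd_y'
  have sum_G: "sum h (verts G) = (h x + h y + h x' + h y' + h l + h m :: real)" for h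
    by (simp add: sum_verts A B)
  have low: "2 \<le> sum h (verts G)" if h: "resolving_function G h" for h
  proof -
    have "1 \<le> sum h {x, y', l}"
      using common_neighbour_not_resolving[OF simple, of y x y']
        common_neighbour_not_resolving[OF simple, of x' x y']
        distance_two_not_resolving[OF simple, of m x y'] resolving_set_subset_verts[of G x y'] fresh l
      by (intro resolving_function_pair[OF simple h, of x y']) (auto simp: V nb)
    moreover have "1 \<le> sum h {y, x', m}"
      using common_neighbour_not_resolving[OF simple, of x y x']
        common_neighbour_not_resolving[OF simple, of y' y x']
        distance_two_not_resolving[OF simple, of l y x'] resolving_set_subset_verts[of G y x'] fresh l
      by (intro resolving_function_pair[OF simple h, of y x']) (auto simp: V nb)
    ultimately show ?thesis using fresh l by (simp add: sum_G)
  qed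
  show "Sd_f G (complement G) = 2" "dim_f G = 2"
    using Sd_f_eq_dim_f[OF simple half_leaves_on_both sum_half_leaves_on_both] low A B by simp_all
  have x: "x \<in> resolving_set (complement G) y x'"
    using fresh l by (intro resolving_set_complement_dominating[OF simple])
      (auto simp: dominating_edge_def V nb)
  let ?H = "{x, x', y', l, m}"
  define R where "R u v \<longleftrightarrow> 3 \<le> card (?H \<inter> resolving_set (complement G) u v)" for u v
  have R_sym: "R u v \<longleftrightarrow> R v u" for u v
    by (simp add: R_def resolving_set_commute)
  have three: "R u v"
    if "distinct [p, q, r]" "{p, q, r} \<subseteq> ?H \<inter> resolving_set (complement G) u v" for p q r u v
    unfolding R_def using card_ge_3I[of "?H \<inter> resolving_set (complement G) u v" p q r] that by auto
  have three_adj: "R u v"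
    if "u \<in> verts G" "v \<in> verts G" "u \<noteq> v" "distinct [p, q, r]"
      "{p, q, r} \<subseteq> ?H \<inter> adj_res_set G u v" for p q r u v
    using three[OF that(4)] that(5) adj_res_set_subset_complement[OF simple that(1-3)] by blast
  note simps = adj_res_set_def nb V
  have Rx: "R x y" "R x x'" "R x y'" "R x l" "R x m"
    using fresh l three_adj[of x y l m x] three_adj[of x x' x x' l] three_adj[of x y' x y' l]
      three_adj[of x l x l x'] three_adj[of x m x m l] by (auto simp: simps)
  have Ry: "R y y'" "R y l" "R y m"
    using fresh l three_adj[of y y' y' x m] three_adj[of y l l y' m] three_adj[of y m m x y']
    by (auto simp: simps)
  \<comment> \<open>Of the vertices with weight, adjacency supplies only \<open>x'\<close> and \<open>m\<close>; the third is \<open>x\<close>, across \<open>xy\<close>.\<close>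
  have Ryx': "R y x'"
    using fresh l x adj_res_set_subset_complement[OF simple, of y x'] three[of x x' m y x']
    by (auto simp: simps)
  have Rx': "R x' y'" "R x' l" "R x' m"
    using fresh l three_adj[of x' y' x' y' x] three_adj[of x' l x' l y'] three_adj[of x' m x' m x]
    by (auto simp: simps)
  have Ry': "R y' l" "R y' m" "R l m"
    using fresh l three_adj[of y' l y' l x'] three_adj[of y' m y' m x'] three_adj[of l m l m x]
    by (auto simp: simps)
  show "dim_f (complement G) = 5 / 3"
  proof (rule dim_f_eqI)
    show "resolving_function (complement G) (uniform_on 3 ?H)"
    proof (rule uniform_on_resolving[OF simple_graph_complement[OF simple]])
      fix u v assume "u \<in> verts (complement G)" "v \<in> verts (complement G)" "u \<noteq> v"
      then have "R u v"
        using Rx Ry Ryx' Rx' Ry' R_sym unfolding verts_complement V by blast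
      then show "3 \<le> card (?H \<inter> resolving_set (complement G) u v)" by (simp add: R_def)
    qed simp
    show "sum (uniform_on 3 ?H) (verts (complement G)) = 5 / 3"
      using fresh l by (simp add: sum_G uniform_on_def)
  next
    fix h assume h: "resolving_function (complement G) h"
    have ne: "A \<noteq> {}" "B \<noteq> {}" using A B by auto
    show "5 / 3 \<le> sum h (verts (complement G))"
      using pair_x_leaf[OF h A] pair_x_y'[OF h A ne(2)] pair_x'_leaf[OF h _ ne(2), of l]
        swapped.pair_x_leaf[OF h B] swapped.pair_x_y'[OF h B ne(1)]
        swapped.pair_x'_leaf[OF h _ ne(1), of m] pair_leaves[OF h A B] A B
      by (simp add: sum_G)
  qed
qed

section \<open>The three cases of the theorem\<close>

lemma (in spine_triangle) Sd_f_eq_dim_f_complement_if_not_H1: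
  assumes "\<not> isomorphic G H1"
  shows "Sd_f G (complement G) = dim_f (complement G)"
proof -
  interpret swapped: spine_triangle G y x w B A by (rule swap)
  have not_single: False if "spine_triangle G p q r {l} {}" for p q r l
    using assms that isomorphic_H1_iff[OF simple] by blast
  consider "A \<noteq> {}" "B \<noteq> {}" | "B = {}" | "A = {}" by blast
  then show ?thesis
  proof cases
    case 1
    then show ?thesis by (rule Sd_f_leaves_on_both)
  next
    case 2
    have "card A \<noteq> 1"
      using not_single spine_triangle_axioms 2 by (auto simp: card_1_singleton_iff)
    then show ?thesis by (rule Sd_f_leaves_on_x[OF 2])
  next
    case 3
    have "card B \<noteq> 1"
      using not_single swap 3 by (auto simp: card_1_singleton_iff)
    then show ?thesis by (rule swapped.Sd_f_leaves_on_x[OF 3])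
  qed
qed

lemma (in side_triangle) Sd_f_eq_dim_f_complement_if_not_H1:
  assumes "\<not> isomorphic G H1"
  shows "Sd_f G (complement G) = dim_f (complement G)"
proof (cases "B = {}")
  case True
  then interpret spine: spine_triangle G x v w "insert y A" "{}"
    by (rule spine_triangle_if_no_leaf_on_y)
  show ?thesis by (rule spine.Sd_f_eq_dim_f_complement_if_not_H1[OF assms])
next
  case False
  then show ?thesis by (rule Sd_f_leaf_on_y)
qed

lemma (in spine_square) Sd_f_eq_dim_f_complement_if_not_H2_H3:
  assumes "\<not> isomorphic G H2" "\<not> isomorphic G H3"
  shows "Sd_f G (complement G) = dim_f (complement G)"
proof -
  interpret swapped: spine_square G y x y' x' B A by (rule swap)
  have not_H2: False if "spine_square G p q p' q' {l} {}" for p q p' q' l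
    using assms(1) that isomorphic_H2_iff[OF simple] by blast
  have not_H3: False if "spine_square G p q p' q' {l} {m}" for p q p' q' l m
    using assms(2) that isomorphic_H3_iff[OF simple] by blast
  have size: "T = {} \<or> (\<exists>l. T = {l}) \<or> 2 \<le> card T" if "finite T" for T :: "'a set"
  proof -
    have "card T = 0 \<or> card T = 1 \<or> 2 \<le> card T" by linarith
    then show ?thesis using that by (auto simp: card_1_singleton_iff)
  qed
  consider "A = {}" "B = {}" | l where "A = {l}" "B = {}" | l where "A = {}" "B = {l}"
    | l m where "A = {l}" "B = {m}" | "2 \<le> card A" "B = {}" | "A = {}" "2 \<le> card B"
    | l where "A = {l}" "2 \<le> card B" | l where "2 \<le> card A" "B = {l}" | "2 \<le> card A" "2 \<le> card B"
    using size[OF finite_leaves(1)] size[OF finite_leaves(2)] by blast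
  then show ?thesis
  proof cases
    case 1
    then show ?thesis by (rule Sd_f_no_leaves)
  next
    case 2
    then show ?thesis using not_H2 spine_square_axioms by blast
  next
    case 3
    then show ?thesis using not_H2 swap by blast
  next
    case 4
    then show ?thesis using not_H3 spine_square_axioms by blast
  next
    case 5
    then show ?thesis by (intro Sd_f_leaves_on_x)
  next
    case 6
    then show ?thesis by (intro swapped.Sd_f_leaves_on_x)
  next
    case 7
    then show ?thesis by (rule Sd_f_single_leaf_on_x)
  next
    case 8
    then show ?thesis by (intro swapped.Sd_f_single_leaf_on_x)
  next
    case 9
    then show ?thesis by (rule Sd_f_many_leaves_on_both)
  qed
qed

theorem theorem3p17:
  fixes G :: "'a graph"
  assumes "unicyclic G" and "card (verts G) \<ge> 3"
  shows "((isomorphic G H1 \<or> isomorphic G H2) \<longrightarrow>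
            Sd_f G (complement G) = dim_f G \<and> dim_f G = dim_f (complement G) + 1 / 2) \<and>
         (isomorphic G H3 \<longrightarrow>
            Sd_f G (complement G) = dim_f G \<and> dim_f G = dim_f (complement G) + 1 / 3) \<and>
         (\<not> isomorphic G H1 \<and> \<not> isomorphic G H2 \<and> \<not> isomorphic G H3 \<longrightarrow>
            Sd_f G (complement G) = dim_f (complement G))"
proof (intro conjI[of "_ \<longrightarrow> _"] impI)
  have G: "simple_graph G" using assms(1) by (simp add: unicyclic_def)
  show "Sd_f G (complement G) = dim_f G \<and> dim_f G = dim_f (complement G) + 1 / 2"
    if "isomorphic G H1 \<or> isomorphic G H2"
    using that
  proof
    assume "isomorphic G H1"
    then obtain x y w l where "spine_triangle G x y w {l} {}"
      using isomorphic_H1_iff[OF G] by blast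
    from spine_triangle.single_leaf_values[OF this refl refl] show ?thesis by simp
  next
    assume "isomorphic G H2"
    then obtain x y x' y' l where "spine_square G x y x' y' {l} {}"
      using isomorphic_H2_iff[OF G] by blast
    from spine_square.single_leaf_values[OF this refl refl] show ?thesis by simp
  qed
  show "Sd_f G (complement G) = dim_f G \<and> dim_f G = dim_f (complement G) + 1 / 3"
    if "isomorphic G H3"
  proof -
    obtain x y x' y' l m where "spine_square G x y x' y' {l} {m}"
      using \<open>isomorphic G H3\<close> isomorphic_H3_iff[OF G] by blast
    from spine_square.single_leaf_on_both_values[OF this refl refl] show ?thesis by simp
  qed
  show "Sd_f G (complement G) = dim_f (complement G)"
    if not_iso: "\<not> isomorphic G H1 \<and> \<not> isomorphic G H2 \<and> \<not> isomorphic G H3"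
  proof (cases "\<exists>x y. dominating_edge G x y")
    case False
    then show ?thesis by (intro Sd_f_eq_if_no_dominating_edge[OF G]) blast
  next
    case True
    then obtain x y where "dominating_edge G x y" by blast
    with assms(1) show ?thesis
    proof (cases rule: unicyclic_dominating_edge_cases)
      case (1 w A B)
      show ?thesis using not_iso by (intro spine_triangle.Sd_f_eq_dim_f_complement_if_not_H1[OF 1]) simp_all
    next
      case (2 v w A B)
      show ?thesis using not_iso by (intro side_triangle.Sd_f_eq_dim_f_complement_if_not_H1[OF 2]) simp_all
    next
      case (3 v w A B)
      show ?thesis using not_iso by (intro side_triangle.Sd_f_eq_dim_f_complement_if_not_H1[OF 3]) simp_all
    next
      case (4 x' y' A B)
      show ?thesis using not_iso by (intro spine_square.Sd_f_eq_dim_f_complement_if_not_H2_H3[OF 4]) simp_all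
    qed
  qed
qed

end
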